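(* Let $\{X_t : t=0,1,2,\dots\}$ be a non-negative homogeneous Markov chain with initial distribution $F_0$ and transition kernel $\pi$ satisfying Assumptions F$_0$, B1 and B2 (stated in full in the context), with associated $H_0,\sigma,b,K,b_s,\psi^b_s$ ($s=1,2,\dots$). Then, for every $t\in\{1,2,\dots\}$, as $u\uparrow\infty$, the conditional distribution of $$\left(\frac{X_0-u}{\sigma(u)},\frac{X_1}{b_1(X_0)},\frac{X_2}{b_2(X_0)},\dots,\frac{X_t}{b_t(X_0)}\right)\quad\text{given } X_0>u$$ converges weakly (on $[0,\infty)\times[0,\infty)^t$) to the distribution of $(E_0,M_1,M_2,\dots,M_t)$, where (i) $E_0\sim H_0$, and $E_0$ and the vector $(M_1,M_2,\dots,M_t)$ are independent; (ii) $M_1\sim K$ and $M_{s+1}=\psi^b_s(M_s)\,\varepsilon_s$ for $s=1,2,\dots$, where $\varepsilon_1,\varepsilon_2,\dots$ is an i.i.d. sequence with $\varepsilon_s\sim K$, independent of $M_1$.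
   Context: Notation: $F_0(x)=\Pr(X_0\le x)$ and $\overline F_0=1-F_0$; $\pi(x,A)=\Pr(X_{t+1}\in A\mid X_t=x)$. For $\beta>0$, $\pi(v,\beta\,dx)$ denotes the law of $Z/\beta$ when $Z\sim\pi(v,\cdot)$. $F_0(u+\sigma(u)dx)/\overline F_0(u)$, $x\ge 0$, denotes the conditional law of $(X_0-u)/\sigma(u)$ given $X_0>u$. Functions "converge uniformly on compact sets in the variable $x\in E$" if for every compact $C\subset E$ the supremum over $x\in C$ of the absolute difference to the limit tends to $0$. Since $K(\{0\})=0$, the $M_s$ are almost surely positive, so the value assigned to $\psi^b_s$ at $0$ is irrelevant (one may set $\psi^b_s(0)=1$). Assumption F$_0$: $F_0$ has upper endpoint $\infty$ and there exist a probability distribution $H_0$ on $[0,\infty)$ and a measurable function $\sigma(u)>0$ such that $F_0(u+\sigma(u)dx)/\overline F_0(u)$ converges weakly to $H_0(dx)$ as $u\uparrow\infty$. Assumption B1: There exist a measurable function $b(v)>0$ and a non-degenerate probability distribution $K$ on $[0,\infty)$ with $K(\{0\})=0$ such that $\pi(v,b(v)dx)$ converges weakly to $K(dx)$ as $v\uparrow\infty$. Assumption B2: (a) With $b_1=b$, there exist measurable functions $b_t(v)>0$ for $t=2,3,\dots$ such that $b_t(v)\to\infty$ as $v\uparrow\infty$ for all $t=1,2,\dots$. (b) There exist continuous functions $$\psi^b_t(x)=\lim_{v\to\infty}\frac{b(b_t(v)x)}{b_{t+1}(v)}>0,$$ defined for $x\in(0,\infty)$, $t=1,2,\dots$, such that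 the remainder term $$r^b_t(v,x)=1-\frac{b_{t+1}(v)\psi^b_t(x)}{b(b_t(v)x)}$$ converges to $0$ as $v\uparrow\infty$, the convergence holding uniformly on compact sets in the variable $x\in[\delta,\infty)$ for any $\delta>0$. (c) For each $t=1,2,\dots$, $\sup\{x>0:\psi^b_t(x)\le c\}\to 0$ as $c\downarrow 0$, with the convention $\sup(\emptyset)=0$. *)

theory Defs
  imports "HOL-Probability.Probability"
begin

text \<open>
  All laws on the half-line are Borel measures on \<open>real\<close> that give full mass to \<open>{0..}\<close>.
\<close>

definition half_line_distribution :: "real measure \<Rightarrow> bool" where
  "half_line_distribution H \<longleftrightarrow> real_distribution H \<and> measure H {0..} = 1"

text \<open>
  Weak convergence of \<open>N u\<close> to \<open>L\<close> along the filter \<open>F\<close>, as laws on the topological space \<open>T\<close>.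
  Test functions need only be defined, bounded and continuous on \<open>T\<close>, hence the integrals over
  \<open>topspace T\<close>. The measures are meant to be probability measures concentrated on
  \<open>topspace T\<close> whose sigma-algebra induces the Borel sets of \<open>T\<close>; this is the case at every use
  below, where \<open>T\<close> is a closed subspace of a finite power of the reals.
\<close>

definition weakly_converges ::
  "'b topology \<Rightarrow> ('a \<Rightarrow> 'b measure) \<Rightarrow> 'b measure \<Rightarrow> 'a filter \<Rightarrow> bool" where
  "weakly_converges T N L F \<longleftrightarrow>
     (\<forall>f::'b \<Rightarrow> real. continuous_map T euclideanreal f \<and> bounded (f ` topspace T) \<longrightarrow>
        ((\<lambda>u. LINT x:topspace T|N u. f x) \<longlongrightarrow> (LINT x:topspace T|L. f x)) F)"

abbreviation half_line :: "real topology" where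
  "half_line \<equiv> top_of_set {0..}"

abbreviation half_line_power :: "nat \<Rightarrow> (nat \<Rightarrow> real) topology" where
  "half_line_power t \<equiv> product_topology (\<lambda>_. half_line) {0..t}"

text \<open>The sigma-algebra generated by \<open>X 0, \<dots>, X t\<close>.\<close>

definition history :: "'w measure \<Rightarrow> (nat \<Rightarrow> 'w \<Rightarrow> real) \<Rightarrow> nat \<Rightarrow> 'w measure" where
  "history M X t =
     vimage_algebra (space M) (\<lambda>\<omega>. \<lambda>s\<in>{0..t}. X s \<omega>) (Pi\<^sub>M {0..t} (\<lambda>_. borel))"

definition half_line_kernel :: "(real \<Rightarrow> real measure) \<Rightarrow> bool" where
  "half_line_kernel \<pi> \<longleftrightarrow>
     \<pi> \<in> restrict_space borel {0..} \<rightarrow>\<^sub>M prob_algebra borel \<and>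
     (\<forall>x\<ge>0. measure (\<pi> x) {0..} = 1)"

definition markov_chain ::
  "'w measure \<Rightarrow> (nat \<Rightarrow> 'w \<Rightarrow> real) \<Rightarrow> real measure \<Rightarrow> (real \<Rightarrow> real measure) \<Rightarrow> bool" where
  "markov_chain M X F\<^sub>0 \<pi> \<longleftrightarrow>
     prob_space M \<and>
     half_line_kernel \<pi> \<and>
     (\<forall>t. X t \<in> borel_measurable M) \<and>
     (\<forall>t. \<forall>\<omega>\<in>space M. 0 \<le> X t \<omega>) \<and>
     distr M borel (X 0) = F\<^sub>0 \<and>
     (\<forall>t. \<forall>A\<in>sets borel. AE \<omega> in M.
        real_cond_exp M (history M X t) (\<lambda>\<omega>'. indicator A (X (Suc t) \<omega>')) \<omega>
          = measure (\<pi> (X t \<omega>)) A)"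

definition positive_measurable :: "(real \<Rightarrow> real) \<Rightarrow> bool" where
  "positive_measurable g \<longleftrightarrow>
     g \<in> borel_measurable (restrict_space borel {0..}) \<and> (\<forall>v\<ge>0. 0 < g v)"

definition assumption_F0 :: "real measure \<Rightarrow> real measure \<Rightarrow> (real \<Rightarrow> real) \<Rightarrow> bool" where
  "assumption_F0 F\<^sub>0 H\<^sub>0 \<sigma> \<longleftrightarrow>
     (\<forall>x. cdf F\<^sub>0 x < 1) \<and>
     half_line_distribution H\<^sub>0 \<and>
     positive_measurable \<sigma> \<and>
     weakly_converges half_line
       (\<lambda>u. distr (uniform_measure F\<^sub>0 {u<..}) borel (\<lambda>x. (x - u) / \<sigma> u)) H\<^sub>0 at_top"

text \<open>Non-degeneracy means that \<open>K\<close> is not a point mass.\<close>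

definition assumption_B1 ::
  "(real \<Rightarrow> real measure) \<Rightarrow> (real \<Rightarrow> real) \<Rightarrow> real measure \<Rightarrow> bool" where
  "assumption_B1 \<pi> b K \<longleftrightarrow>
     positive_measurable b \<and>
     half_line_distribution K \<and>
     (\<forall>c. K \<noteq> return borel c) \<and>
     measure K {0} = 0 \<and>
     weakly_converges half_line (\<lambda>v. distr (\<pi> v) borel (\<lambda>z. z / b v)) K at_top"

definition remainder ::
  "(real \<Rightarrow> real) \<Rightarrow> (nat \<Rightarrow> real \<Rightarrow> real) \<Rightarrow> (nat \<Rightarrow> real \<Rightarrow> real) \<Rightarrow> nat \<Rightarrow> real \<Rightarrow> real \<Rightarrow> real"
  where
  "remainder b bs \<psi> t v x = 1 - bs (Suc t) v * \<psi> t x / b (bs t v * x)"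

text \<open>
  In the last clause the supremum may be infinite, so it is taken in the extended reals;
  adding the point 0 to a set of positive numbers implements the convention that the
  supremum of the empty set is 0. The values \<open>bs 0\<close>, \<open>\<psi> 0\<close>, and \<open>\<psi> t x\<close> for
  \<open>x \<le> 0\<close>, are unconstrained.
\<close>

definition assumption_B2 ::
  "(real \<Rightarrow> real) \<Rightarrow> (nat \<Rightarrow> real \<Rightarrow> real) \<Rightarrow> (nat \<Rightarrow> real \<Rightarrow> real) \<Rightarrow> bool" where
  "assumption_B2 b bs \<psi> \<longleftrightarrow>
     bs 1 = b \<and>
     (\<forall>t\<ge>1. positive_measurable (bs t) \<and> filterlim (bs t) at_top at_top) \<and>
     (\<forall>t\<ge>1. continuous_on {0<..} (\<psi> t) \<and>
        (\<forall>x>0. 0 < \<psi> t x \<and> ((\<lambda>v. b (bs t v * x) / bs (Suc t) v) \<longlongrightarrow> \<psi> t x) at_top) \<and>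
        (\<forall>\<delta>>0. \<forall>C. compact C \<and> C \<subseteq> {\<delta>..} \<longrightarrow>
           uniform_limit C (remainder b bs \<psi> t) (\<lambda>_. 0) at_top)) \<and>
     (\<forall>t\<ge>1. ((\<lambda>c. Sup (insert 0 (ereal ` {x. 0 < x \<and> \<psi> t x \<le> c}))) \<longlongrightarrow> 0) (at_right 0))"

text \<open>
  Independence of two random variables; \<open>indep_var\<close> requires both to have the same type
  of values, which excludes a real variable and a random vector.
\<close>

definition independent_variables ::
  "'v measure \<Rightarrow> 'a measure \<Rightarrow> ('v \<Rightarrow> 'a) \<Rightarrow> 'b measure \<Rightarrow> ('v \<Rightarrow> 'b) \<Rightarrow> bool" where
  "independent_variables N S f T g \<longleftrightarrow>
     f \<in> N \<rightarrow>\<^sub>M S \<and> g \<in> N \<rightarrow>\<^sub>M T \<and>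
     prob_space.indep_set N (sets (vimage_algebra (space N) f S)) (sets (vimage_algebra (space N) g T))"

text \<open>
  \<open>E\<^sub>0\<close>, \<open>Y 1, Y 2, \<dots>\<close> and \<open>\<epsilon> 1, \<epsilon> 2, \<dots>\<close> on the probability space \<open>N\<close> realise the limit:
  \<open>Y s\<close> is the limit variable for \<open>X s / bs s (X 0)\<close>. The recursion is only required almost
  surely, since \<open>\<psi> s\<close> is only meaningful on the positive half-line.
\<close>

definition tail_chain ::
  "'v measure \<Rightarrow> real measure \<Rightarrow> real measure \<Rightarrow> (nat \<Rightarrow> real \<Rightarrow> real) \<Rightarrow>
   ('v \<Rightarrow> real) \<Rightarrow> (nat \<Rightarrow> 'v \<Rightarrow> real) \<Rightarrow> (nat \<Rightarrow> 'v \<Rightarrow> real) \<Rightarrow> bool" where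
  "tail_chain N H\<^sub>0 K \<psi> E\<^sub>0 Y \<epsilon> \<longleftrightarrow>
     prob_space N \<and>
     E\<^sub>0 \<in> borel_measurable N \<and>
     (\<forall>s\<ge>1. Y s \<in> borel_measurable N) \<and>
     (\<forall>s\<ge>1. \<epsilon> s \<in> borel_measurable N) \<and>
     distr N borel E\<^sub>0 = H\<^sub>0 \<and>
     (\<forall>t\<ge>1. independent_variables N borel E\<^sub>0
        (Pi\<^sub>M {1..t} (\<lambda>_. borel)) (\<lambda>\<omega>. \<lambda>s\<in>{1..t}. Y s \<omega>)) \<and>
     distr N borel (Y 1) = K \<and>
     (\<forall>s\<ge>1. AE \<omega> in N. Y (Suc s) \<omega> = \<psi> s (Y s \<omega>) * \<epsilon> s \<omega>) \<and>
     (\<forall>s\<ge>1. distr N borel (\<epsilon> s) = K) \<and>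
     prob_space.indep_vars N (\<lambda>_. borel) \<epsilon> {1..} \<and>
     independent_variables N borel (Y 1)
        (Pi\<^sub>M {1..} (\<lambda>_. borel)) (\<lambda>\<omega>. \<lambda>s\<in>{1..}. \<epsilon> s \<omega>)"

definition conditional_law ::
  "'w measure \<Rightarrow> (nat \<Rightarrow> 'w \<Rightarrow> real) \<Rightarrow> (real \<Rightarrow> real) \<Rightarrow> (nat \<Rightarrow> real \<Rightarrow> real) \<Rightarrow>
   nat \<Rightarrow> real \<Rightarrow> (nat \<Rightarrow> real) measure" where
  "conditional_law M X \<sigma> bs t u =
     distr (uniform_measure M {\<omega> \<in> space M. u < X 0 \<omega>}) (Pi\<^sub>M {0..t} (\<lambda>_. borel))
       (\<lambda>\<omega>. \<lambda>s\<in>{0..t}. if s = 0 then (X 0 \<omega> - u) / \<sigma> u else X s \<omega> / bs s (X 0 \<omega>))"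

definition limit_law ::
  "'v measure \<Rightarrow> ('v \<Rightarrow> real) \<Rightarrow> (nat \<Rightarrow> 'v \<Rightarrow> real) \<Rightarrow> nat \<Rightarrow> (nat \<Rightarrow> real) measure" where
  "limit_law N E\<^sub>0 Y t =
     distr N (Pi\<^sub>M {0..t} (\<lambda>_. borel)) (\<lambda>\<omega>. \<lambda>s\<in>{0..t}. if s = 0 then E\<^sub>0 \<omega> else Y s \<omega>)"

end

theory Submission
  imports Defs
begin

text \<open>
  Condition successively, starting from the last time: the conditional expectation of a test function
  given the first \<open>s\<close> normalised values is an iterated integral along the transition kernels, and
  these integrals converge continuously, that is, along every convergent sequence of states with
  positive limit. Backward induction on \<open>s\<close> proves this, each step being Skorohod representation of
  the weak convergence in B1 followed by dominated convergence; zero is avoided because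
  \<open>K {0} = 0\<close>. At time 0 the initial value is at least \<open>u\<close> and hence tends to infinity whatever
  the normalised excess is, which makes the excess asymptotically independent of the rest. Hence
  only one-dimensional weak convergence is ever used, and no tightness argument.
\<close>

section \<open>Iterated kernels\<close>

text \<open>The normalised chain need not be Markov in its last coordinate:
  \<open>bs (Suc s)\<close> is evaluated at the initial value, so each kernel has to read coordinate
  0 as well, and the iteration acts on paths. When the iterated integrals pass to the limit, measure
  and integrand move together, and the integrand is only measurable in the state, because nothing
  makes \<open>\<pi>\<close> depend continuously on it. Testing weak convergence against one fixed
  continuous function is therefore too weak. Convergence along arbitrary convergent sequences of
  states is the right substitute: it makes sense for discontinuous prelimit integrands, it follows
  from the locally uniform convergence in B2, and by the present lemma the integral inherits it. It
  may fail at states with a zero coordinate, where \<open>\<psi> s\<close> has no meaning; hence the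
  condition \<open>P\<close>.\<close>

lemma extended_continuous_mapping:
  fixes f :: "real \<Rightarrow> real" and fs :: "nat \<Rightarrow> real \<Rightarrow> real"
  assumes \<mu>: "\<And>n. real_distribution (\<mu> n)" and L: "real_distribution L"
    and conv: "weak_conv_m \<mu> L"
    and fs: "\<And>n. fs n \<in> borel_measurable borel" and f: "f \<in> borel_measurable borel"
    and bound: "\<And>n x. \<bar>fs n x\<bar> \<le> B"
    and D: "AE x in L. P x"
    and lim: "\<And>x xs. P x \<Longrightarrow> xs \<longlonglongrightarrow> x \<Longrightarrow> (\<lambda>n. fs n (xs n)) \<longlonglongrightarrow> f x"
  shows "(\<lambda>n. \<integral>x. fs n x \<partial>\<mu> n) \<longlonglongrightarrow> (\<integral>x. f x \<partial>L)"
proof -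
  note [measurable] = fs f
  obtain \<Omega> :: "real measure" and ys :: "nat \<Rightarrow> real \<Rightarrow> real" and y :: "real \<Rightarrow> real"
    where \<Omega>: "prob_space \<Omega>" and ys [measurable]: "\<And>n. ys n \<in> borel_measurable \<Omega>"
      and ys_distr: "\<And>n. distr \<Omega> borel (ys n) = \<mu> n"
      and "y \<in> measurable \<Omega> lborel" and y_distr: "distr \<Omega> borel y = L"
      and ys_lim: "\<And>x. x \<in> space \<Omega> \<Longrightarrow> (\<lambda>n. ys n x) \<longlonglongrightarrow> y x"
    using Skorohod[OF \<mu> L conv] by metis
  then have y [measurable]: "y \<in> borel_measurable \<Omega>" by simp
  interpret \<Omega>: prob_space \<Omega> by fact
  have "AE x in distr \<Omega> borel y. P x"
    unfolding y_distr by (rule D)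
  then have AE: "AE \<omega> in \<Omega>. P (y \<omega>)"
    by (rule AE_distrD[OF y])
  \<comment> \<open>\<open>P\<close> is asked of the limit point \<open>y \<omega>\<close> only, so
    it suffices that the limit law ignores the bad states; the convergence of
    \<open>ys n \<omega>\<close> then triggers \<open>lim\<close> at almost every
    \<open>\<omega>\<close>.\<close>
  have "(\<lambda>n. \<integral>\<omega>. fs n (ys n \<omega>) \<partial>\<Omega>) \<longlonglongrightarrow> (\<integral>\<omega>. f (y \<omega>) \<partial>\<Omega>)"
  proof (rule integral_dominated_convergence[where w="\<lambda>_. B"])
    show "AE \<omega> in \<Omega>. (\<lambda>n. fs n (ys n \<omega>)) \<longlonglongrightarrow> f (y \<omega>)"
      using AE AE_space by eventually_elim (rule lim, auto intro: ys_lim)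
  qed (use bound in auto)
  then show ?thesis
    by (simp add: integral_distr flip: ys_distr y_distr)
qed

text \<open>
  States are finite paths, encoded as sequences that vanish beyond the current time. The kernel
  \<open>\<kappa> s\<close> draws coordinate \<open>Suc s\<close>, and \<open>iter \<kappa> g j s z\<close> is the expectation of \<open>g\<close> after \<open>j\<close>
  further draws.
\<close>

primrec iter ::
  "(nat \<Rightarrow> (nat \<Rightarrow> real) \<Rightarrow> real measure) \<Rightarrow> ((nat \<Rightarrow> real) \<Rightarrow> real) \<Rightarrow>
   nat \<Rightarrow> nat \<Rightarrow> (nat \<Rightarrow> real) \<Rightarrow> real" where
  "iter \<kappa> g 0 s z = g z"
| "iter \<kappa> g (Suc j) s z = (\<integral>y. iter \<kappa> g j (Suc s) (z(Suc s := y)) \<partial>\<kappa> s z)"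

lemma measurable_fun_upd_borel [measurable (raw)]:
  fixes f :: "'a \<Rightarrow> nat \<Rightarrow> real"
  assumes "f \<in> borel_measurable M" "h \<in> borel_measurable M"
  shows "(\<lambda>x. (f x)(i := h x)) \<in> borel_measurable M"
proof (rule measurable_coordinatewise_then_product)
  fix k show "(\<lambda>x. ((f x)(i := h x)) k) \<in> borel_measurable M"
    using measurable_compose[OF assms(1) measurable_product_coordinates] assms(2)
    by (cases "k = i") auto
qed

lemma tendsto_fun_iff:
  fixes f :: "'a \<Rightarrow> nat \<Rightarrow> real"
  shows "(f \<longlongrightarrow> l) F \<longleftrightarrow> (\<forall>i. ((\<lambda>x. f x i) \<longlongrightarrow> l i) F)"
  using limitin_componentwise[of "\<lambda>_::nat. euclideanreal" UNIV f l F]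
  by (simp add: euclidean_product_topology)

lemma tendsto_fun_upd:
  fixes f :: "'a \<Rightarrow> nat \<Rightarrow> real"
  assumes "(f \<longlongrightarrow> l) F" "(h \<longlongrightarrow> a) F"
  shows "((\<lambda>x. (f x)(i := h x)) \<longlongrightarrow> l(i := a)) F"
  using assms by (auto simp: tendsto_fun_iff)

text \<open>The point \<open>x\<close> moves from the integrand into the measure: one fixed function
  on the product is integrated against the law of \<open>(x, y)\<close>, and integration of a fixed
  function is a measurable functional on \<open>subprob_algebra\<close>.\<close>

lemma integral_kernel_measurable:
  fixes h :: "'a \<Rightarrow> real \<Rightarrow> real"
  assumes "\<kappa> \<in> M \<rightarrow>\<^sub>M prob_algebra borel" "(\<lambda>(x, y). h x y) \<in> borel_measurable (M \<Otimes>\<^sub>M borel)"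
  shows "(\<lambda>x. \<integral>y. h x y \<partial>\<kappa> x) \<in> borel_measurable M"
proof -
  note [measurable] = assms measurable_prob_algebraD[OF assms(1)]
  have "(\<lambda>x. integral\<^sup>L (distr (\<kappa> x) (M \<Otimes>\<^sub>M borel) (Pair x)) (\<lambda>(x, y). h x y)) \<in> borel_measurable M"
    by (rule measurable_compose[OF measurable_distr2[OF _ measurable_prob_algebraD[OF assms(1)]]
          integral_measurable_subprob_algebra[OF assms(2)]]) simp
  then show ?thesis
    by (rule measurable_cong[THEN iffD1, rotated])
       (simp add: integral_distr subprob_measurableD[OF measurable_prob_algebraD[OF assms(1)]])
qed

lemma prob_algebra_kernelD:
  assumes "\<kappa> \<in> M \<rightarrow>\<^sub>M prob_algebra borel" "x \<in> space M"
  shows "real_distribution (\<kappa> x)"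
  using measurable_space[OF assms]
  by (auto simp: space_prob_algebra real_distribution_def real_distribution_axioms_def)

lemma integral_abs_le_bound:
  assumes "prob_space M" "f \<in> borel_measurable M" "\<And>x. \<bar>f x\<bar> \<le> B"
  shows "\<bar>\<integral>x. f x \<partial>M\<bar> \<le> (B::real)"
proof -
  interpret prob_space M by fact
  have int: "integrable M f" by (rule integrable_const_bound[where B=B]) (use assms in auto)
  have "norm (integral\<^sup>L M f) \<le> (\<integral>x. norm (f x) \<partial>M)" by (rule integral_norm_bound)
  also have "\<dots> \<le> (\<integral>x. B \<partial>M)" using int assms(3) by (intro integral_mono) auto
  finally show ?thesis by (simp add: prob_space)
qed

lemma iter_measurable:
  assumes \<kappa>: "\<And>s. \<kappa> s \<in> borel \<rightarrow>\<^sub>M prob_algebra borel" and g: "g \<in> borel_measurable borel"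
  shows "iter \<kappa> g j s \<in> borel_measurable borel"
proof (induction j arbitrary: s)
  case (Suc j)
  note [measurable] = Suc
  show ?case
    unfolding iter.simps by (rule integral_kernel_measurable[OF \<kappa>]) measurable
qed (simp add: g iter.simps(1)[abs_def])

lemma iter_bound:
  assumes \<kappa>: "\<And>s. \<kappa> s \<in> borel \<rightarrow>\<^sub>M prob_algebra borel" and g: "g \<in> borel_measurable borel"
    and bound: "\<And>z. \<bar>g z\<bar> \<le> B"
  shows "\<bar>iter \<kappa> g j s z\<bar> \<le> B"
proof (induction j arbitrary: s z)
  case (Suc j)
  note [measurable] = iter_measurable[OF \<kappa> g]
  interpret real_distribution "\<kappa> s z" by (rule prob_algebra_kernelD[OF \<kappa>]) simp
  show ?case
    unfolding iter.simps
    by (intro integral_abs_le_bound) (use Suc in \<open>auto intro: prob_space_axioms\<close>)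
qed (simp add: bound)

text \<open>The induction generalises over time and paths, since the inner iterate starts one step
  later from a path extended by the variable of integration. Positivity is asked of coordinates 1 to
  \<open>s\<close> only: the limiting excess in coordinate 0 may have an atom at 0.
  \<open>pos\<close> keeps each newly drawn coordinate positive almost surely.\<close>

lemma iter_tendsto:
  fixes \<kappa>s :: "nat \<Rightarrow> nat \<Rightarrow> (nat \<Rightarrow> real) \<Rightarrow> real measure"
  assumes \<kappa>s: "\<And>n s. \<kappa>s n s \<in> borel \<rightarrow>\<^sub>M prob_algebra borel"
    and \<kappa>: "\<And>s. \<kappa> s \<in> borel \<rightarrow>\<^sub>M prob_algebra borel"
    and conv: "\<And>s zs z. zs \<longlonglongrightarrow> z \<Longrightarrow> \<forall>i\<in>{1..s}. 0 < z i \<Longrightarrow> weak_conv_m (\<lambda>n. \<kappa>s n s (zs n)) (\<kappa> s z)"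
    and pos: "\<And>s z. \<forall>i\<in>{1..s}. 0 < z i \<Longrightarrow> AE y in \<kappa> s z. 0 < y"
    and g: "continuous_on UNIV g" and bound: "\<And>z. \<bar>g z\<bar> \<le> B"
    and z: "zs \<longlonglongrightarrow> z" "\<forall>i\<in>{1..s}. 0 < z i"
  shows "(\<lambda>n. iter (\<kappa>s n) g j s (zs n)) \<longlonglongrightarrow> iter \<kappa> g j s z"
  using z
proof (induction j arbitrary: s zs z)
  case 0
  then show ?case
    using continuous_on_tendsto_compose[OF g, of zs z sequentially] by simp
next
  case (Suc j)
  have g' [measurable]: "g \<in> borel_measurable borel"
    by (rule borel_measurable_continuous_onI[OF g])
  note [measurable] = iter_measurable[OF \<kappa>s g'] iter_measurable[OF \<kappa> g']
  show ?case
    unfolding iter.simps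
  proof (rule extended_continuous_mapping[where P="\<lambda>y. 0 < y" and B=B])
    fix y ys assume "(0::real) < y" "ys \<longlonglongrightarrow> y"
    then show "(\<lambda>n. iter (\<kappa>s n) g j (Suc s) ((zs n)(Suc s := ys n)))
        \<longlonglongrightarrow> iter \<kappa> g j (Suc s) (z(Suc s := y))"
      using Suc.prems by (intro Suc.IH tendsto_fun_upd) auto
  qed (use Suc.prems in \<open>auto intro!: prob_algebra_kernelD[OF \<kappa>s] prob_algebra_kernelD[OF \<kappa>] conv pos
         iter_bound[OF \<kappa>s g' bound]\<close>)
qed

text \<open>The tower property for an abstract path process \<open>Z\<close>. It serves both the
  conditioned chain and the tail chain and reduces each to its one-step identity. After
  \<open>j\<close> kernels have been peeled off, the state at time \<open>t - j\<close> still needs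
  \<open>j\<close> draws to reach time \<open>t\<close>.\<close>

lemma integral_path:
  assumes \<kappa>: "\<And>s. \<kappa> s \<in> borel \<rightarrow>\<^sub>M prob_algebra borel"
    and step: "\<And>s (h :: (nat \<Rightarrow> real) \<Rightarrow> real) B. s < t \<Longrightarrow> h \<in> borel_measurable borel \<Longrightarrow> (\<And>z. \<bar>h z\<bar> \<le> B) \<Longrightarrow>
      (\<integral>\<omega>. h (Z (Suc s) \<omega>) \<partial>M) = (\<integral>\<omega>. (\<integral>y. h ((Z s \<omega>)(Suc s := y)) \<partial>\<kappa> s (Z s \<omega>)) \<partial>M)"
    and g: "g \<in> borel_measurable borel" and bound: "\<And>z. \<bar>g z\<bar> \<le> (B::real)"
  shows "(\<integral>\<omega>. g (Z t \<omega>) \<partial>M) = (\<integral>\<omega>. iter \<kappa> g t 0 (Z 0 \<omega>) \<partial>M)"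
proof -
  have "j \<le> t \<Longrightarrow> (\<integral>\<omega>. g (Z t \<omega>) \<partial>M) = (\<integral>\<omega>. iter \<kappa> g j (t - j) (Z (t - j) \<omega>) \<partial>M)" for j
  proof (induction j)
    case (Suc j)
    then show ?case
      using step[of "t - Suc j" "iter \<kappa> g j (t - j)" B]
        iter_measurable[OF \<kappa> g] iter_bound[OF \<kappa> g bound]
      by (simp add: Suc_diff_Suc)
  qed simp
  from this[of t] show ?thesis by simp
qed

section \<open>Transitions of the chain\<close>

text \<open>Averages over the next value with the past frozen, in the \<open>bind\<close> form in
  which the joint law is identified below. The kernel may depend on all of \<open>\<omega>\<close>,
  so that \<open>\<pi> (X s \<omega>)\<close> can be inserted directly.\<close>

lemma integral_bind_pair:
  fixes h :: "'a \<Rightarrow> real \<Rightarrow> real"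
  assumes M: "prob_space M" and U: "U \<in> M \<rightarrow>\<^sub>M S" and \<kappa>: "\<kappa> \<in> M \<rightarrow>\<^sub>M prob_algebra borel"
    and h: "(\<lambda>(x, y). h x y) \<in> borel_measurable (S \<Otimes>\<^sub>M borel)" and bound: "\<And>x y. \<bar>h x y\<bar> \<le> B"
  shows "(\<integral>p. (\<lambda>(x, y). h x y) p \<partial>(M \<bind> (\<lambda>\<omega>. distr (\<kappa> \<omega>) (S \<Otimes>\<^sub>M borel) (Pair (U \<omega>)))))
    = (\<integral>\<omega>. (\<integral>y. h (U \<omega>) y \<partial>\<kappa> \<omega>) \<partial>M)"
proof -
  interpret prob_space M by fact
  define D where "D \<omega> = distr (\<kappa> \<omega>) (S \<Otimes>\<^sub>M borel) (Pair (U \<omega>))" for \<omega>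
  have "(\<lambda>(\<omega>, y). (U \<omega>, y)) \<in> M \<Otimes>\<^sub>M borel \<rightarrow>\<^sub>M S \<Otimes>\<^sub>M (borel :: real measure)"
    using U by measurable
  then have D: "D \<in> M \<rightarrow>\<^sub>M prob_algebra (S \<Otimes>\<^sub>M borel)"
    unfolding D_def by (rule measurable_distr_prob_space2[OF \<kappa>])
  have "AE \<omega> in M. emeasure (D \<omega>) (space (D \<omega>)) \<le> ennreal 1"
  proof (rule AE_I2)
    fix \<omega> assume "\<omega> \<in> space M"
    from measurable_space[OF D this] have "prob_space (D \<omega>)"
      by (simp add: space_prob_algebra)
    then show "emeasure (D \<omega>) (space (D \<omega>)) \<le> ennreal 1"
      by (simp add: prob_space.emeasure_space_1)
  qed
  moreover have "\<bar>(\<lambda>(x, y). h x y) p\<bar> \<le> B" for p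
    by (cases p) (simp add: bound)
  ultimately have "(\<integral>p. (\<lambda>(x, y). h x y) p \<partial>(M \<bind> D)) = (\<integral>\<omega>. (\<integral>p. (\<lambda>(x, y). h x y) p \<partial>D \<omega>) \<partial>M)"
    using integral_bind[OF h _ measurable_prob_algebraD[OF D] finite_measure_axioms] by blast
  also have "\<dots> = (\<integral>\<omega>. (\<integral>y. h (U \<omega>) y \<partial>\<kappa> \<omega>) \<partial>M)"
  proof (rule Bochner_Integration.integral_cong[OF refl])
    fix \<omega> assume \<omega>: "\<omega> \<in> space M"
    have "Pair (U \<omega>) \<in> \<kappa> \<omega> \<rightarrow>\<^sub>M S \<Otimes>\<^sub>M borel"
      unfolding subprob_measurableD[OF measurable_prob_algebraD[OF \<kappa>] \<omega>]
      by (rule measurable_Pair1'[OF measurable_space[OF U \<omega>]])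
    then show "(\<integral>p. (\<lambda>(x, y). h x y) p \<partial>D \<omega>) = (\<integral>y. h (U \<omega>) y \<partial>\<kappa> \<omega>)"
      unfolding D_def by (subst integral_distr[OF _ h]) auto
  qed
  finally show ?thesis unfolding D_def .
qed

lemma subalgebra_history:
  assumes "\<And>t. X t \<in> borel_measurable M"
  shows "subalgebra M (history M X s)"
proof -
  have "(\<lambda>\<omega>. \<lambda>s\<in>{0..s}. X s \<omega>) \<in> M \<rightarrow>\<^sub>M Pi\<^sub>M {0..s} (\<lambda>_. borel)"
    using assms by measurable
  then show ?thesis
    unfolding subalgebra_def history_def by (simp add: sets_image_in_sets)
qed

lemma markov_chain_kernel:
  assumes "markov_chain M X F \<pi>"
  shows "(\<lambda>\<omega>. \<pi> (X s \<omega>)) \<in> M \<rightarrow>\<^sub>M prob_algebra borel"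
proof -
  have "X s \<in> M \<rightarrow>\<^sub>M restrict_space borel {0..}"
    using assms by (intro measurable_restrict_space2) (auto simp: markov_chain_def)
  then show ?thesis
    by (rule measurable_compose) (use assms in \<open>simp add: markov_chain_def half_line_kernel_def\<close>)
qed

text \<open>This is the defining property of conditional expectation, integrated over a history
  event \<open>A\<close>. It is phrased with \<open>emeasure\<close> because that is how two
  measures are compared on a generator.\<close>

lemma markov_chain_rectangle:
  assumes mc: "markov_chain M X F \<pi>" and A: "A \<in> sets (history M X s)" and B: "B \<in> sets borel"
  shows "emeasure M (A \<inter> (X (Suc s) -` B \<inter> space M))
    = (\<integral>\<^sup>+\<omega>. indicator A \<omega> * emeasure (\<pi> (X s \<omega>)) B \<partial>M)"
proof -
  interpret prob_space M using mc by (simp add: markov_chain_def)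
  have X [measurable]: "X t \<in> borel_measurable M" for t
    using mc by (simp add: markov_chain_def)
  note sub = subalgebra_history[of X M s, OF X]
  have A' [measurable]: "A \<in> sets M" using A sub by (auto simp: subalgebra_def)
  note [measurable] = B
  interpret sigma_finite_subalgebra M "history M X s"
    by (rule finite_measure_subalgebra_is_sigma_finite)
      (use sub finite_measure_axioms in \<open>simp add: finite_measure_subalgebra_def finite_measure_subalgebra_axioms_def\<close>)
  note \<pi> = measurable_prob_algebraD[OF markov_chain_kernel[OF mc, of s]]
  have \<pi>_prob: "prob_space (\<pi> (X s \<omega>))" if "\<omega> \<in> space M" for \<omega>
    using measurable_space[OF markov_chain_kernel[OF mc, of s] that] by (simp add: space_prob_algebra)
  have [measurable]: "(\<lambda>\<omega>. measure (\<pi> (X s \<omega>)) B) \<in> borel_measurable M"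
    by (rule measurable_compose[OF \<pi> measurable_measure_subprob_algebra[OF B]])
  have "prob (A \<inter> (X (Suc s) -` B \<inter> space M)) = (\<integral>\<omega>\<in>A. indicator B (X (Suc s) \<omega>) \<partial>M)"
  proof -
    have "(\<integral>\<omega>\<in>A. indicat_real B (X (Suc s) \<omega>) \<partial>M)
        = (\<integral>\<omega>. indicat_real (A \<inter> (X (Suc s) -` B \<inter> space M)) \<omega> \<partial>M)"
      unfolding set_lebesgue_integral_def
      by (intro Bochner_Integration.integral_cong) (auto split: split_indicator)
    then show ?thesis by simp
  qed
  also have "\<dots> = (\<integral>\<omega>\<in>A. real_cond_exp M (history M X s) (\<lambda>\<omega>. indicator B (X (Suc s) \<omega>)) \<omega> \<partial>M)"
    by (rule real_cond_exp_intA[OF _ A], rule integrable_const_bound[where B=1]) auto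
  also have "\<dots> = (\<integral>\<omega>\<in>A. measure (\<pi> (X s \<omega>)) B \<partial>M)"
    unfolding set_lebesgue_integral_def
  proof (rule integral_cong_AE)
    have "AE \<omega> in M. real_cond_exp M (history M X s) (\<lambda>\<omega>. indicator B (X (Suc s) \<omega>)) \<omega>
        = measure (\<pi> (X s \<omega>)) B"
      using mc B by (simp add: markov_chain_def)
    then show "AE \<omega> in M. indicator A \<omega> *\<^sub>R real_cond_exp M (history M X s)
        (\<lambda>\<omega>. indicator B (X (Suc s) \<omega>)) \<omega> = indicator A \<omega> *\<^sub>R measure (\<pi> (X s \<omega>)) B"
      by eventually_elim simp
  qed measurable
  also have "\<dots> = (\<integral>\<omega>. indicator A \<omega> * measure (\<pi> (X s \<omega>)) B \<partial>M)"
    by (simp add: set_lebesgue_integral_def)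
  finally have "emeasure M (A \<inter> (X (Suc s) -` B \<inter> space M))
      = ennreal (\<integral>\<omega>. indicator A \<omega> * measure (\<pi> (X s \<omega>)) B \<partial>M)"
    by (simp add: emeasure_eq_measure)
  also have "\<dots> = (\<integral>\<^sup>+\<omega>. ennreal (indicator A \<omega> * measure (\<pi> (X s \<omega>)) B) \<partial>M)"
    by (intro nn_integral_eq_integral[symmetric] integrable_const_bound[where B=1] AE_I2)
       (auto split: split_indicator simp: prob_space.prob_le_1[OF \<pi>_prob])
  also have "\<dots> = (\<integral>\<^sup>+\<omega>. indicator A \<omega> * emeasure (\<pi> (X s \<omega>)) B \<partial>M)"
    by (intro nn_integral_cong)
       (auto split: split_indicator
         simp: finite_measure.emeasure_eq_measure[OF prob_space.finite_measure[OF \<pi>_prob]])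
  finally show ?thesis .
qed

text \<open>The Markov property is given for one set at a time, with an exceptional null set for
  each, whereas \<open>h\<close> mixes the past with the next value. So the joint law of both is
  identified with a mixture, and \<open>h\<close> is integrated against it.\<close>

lemma markov_chain_transition:
  fixes h :: "'a \<Rightarrow> real \<Rightarrow> real"
  assumes mc: "markov_chain M X F \<pi>" and U: "U \<in> history M X s \<rightarrow>\<^sub>M S"
    and h: "(\<lambda>(x, y). h x y) \<in> borel_measurable (S \<Otimes>\<^sub>M borel)" and bound: "\<And>x y. \<bar>h x y\<bar> \<le> B"
  shows "(\<integral>\<omega>. h (U \<omega>) (X (Suc s) \<omega>) \<partial>M) = (\<integral>\<omega>. (\<integral>y. h (U \<omega>) y \<partial>\<pi> (X s \<omega>)) \<partial>M)"
proof -
  interpret prob_space M using mc by (simp add: markov_chain_def)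
  have X [measurable]: "X t \<in> borel_measurable M" for t
    using mc by (simp add: markov_chain_def)
  have sub: "subalgebra M (history M X s)" by (rule subalgebra_history[OF X])
  have U' [measurable]: "U \<in> M \<rightarrow>\<^sub>M S"
    using U by (rule measurable_from_subalg[OF sub])
  note \<pi> = markov_chain_kernel[OF mc, of s]
  let ?\<kappa> = "\<lambda>\<omega>. distr (\<pi> (X s \<omega>)) (S \<Otimes>\<^sub>M borel) (Pair (U \<omega>))"
  have \<kappa>: "?\<kappa> \<in> M \<rightarrow>\<^sub>M subprob_algebra (S \<Otimes>\<^sub>M borel)"
  proof (rule measurable_prob_algebraD, rule measurable_distr_prob_space2[OF \<pi>])
    show "(\<lambda>(\<omega>, y). (U \<omega>, y)) \<in> M \<Otimes>\<^sub>M borel \<rightarrow>\<^sub>M S \<Otimes>\<^sub>M (borel :: real measure)"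
      by measurable
  qed
  let ?P = "distr M (S \<Otimes>\<^sub>M borel) (\<lambda>\<omega>. (U \<omega>, X (Suc s) \<omega>))"
  interpret P: prob_space ?P by (rule prob_space_distr) measurable
  \<comment> \<open>Rectangles form an intersection-stable generator. The whole space is itself a
    rectangle of finite mass, so a constant sequence exhausts it.\<close>
  have "?P = M \<bind> ?\<kappa>"
  proof (rule measure_eqI_generator_eq[OF Int_stable_pair_measure_generator[of S borel]
        pair_measure_closed, where A="\<lambda>_. space S \<times> (UNIV :: real set)"])
    fix R assume "R \<in> {a \<times> b |a b. a \<in> sets S \<and> b \<in> sets (borel :: real measure)}"
    then obtain A C where R: "R = A \<times> C" and A [measurable]: "A \<in> sets S"
      and C [measurable]: "C \<in> sets (borel :: real measure)" by blast
    have "emeasure ?P R = emeasure M ((U -` A \<inter> space M) \<inter> (X (Suc s) -` C \<inter> space M))"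
      unfolding R by (subst emeasure_distr) (auto intro!: arg_cong[of _ _ "emeasure M"])
    also have "\<dots> = (\<integral>\<^sup>+\<omega>. indicator (U -` A \<inter> space M) \<omega> * emeasure (\<pi> (X s \<omega>)) C \<partial>M)"
      using measurable_sets[OF U A] sub
      by (intro markov_chain_rectangle[OF mc]) (auto simp: subalgebra_def)
    also have "\<dots> = (\<integral>\<^sup>+\<omega>. emeasure (?\<kappa> \<omega>) R \<partial>M)"
    proof (rule nn_integral_cong)
      fix \<omega> assume \<omega>: "\<omega> \<in> space M"
      note [simp] = subprob_measurableD[OF measurable_prob_algebraD[OF \<pi>] \<omega>]
      have "Pair (U \<omega>) \<in> \<pi> (X s \<omega>) \<rightarrow>\<^sub>M S \<Otimes>\<^sub>M borel"
        using measurable_space[OF U' \<omega>] by simp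
      then have "emeasure (?\<kappa> \<omega>) R = emeasure (\<pi> (X s \<omega>)) (Pair (U \<omega>) -` (A \<times> C))"
        unfolding R by (subst emeasure_distr) auto
      then show "indicator (U -` A \<inter> space M) \<omega> * emeasure (\<pi> (X s \<omega>)) C = emeasure (?\<kappa> \<omega>) R"
        using \<omega> by (auto split: split_indicator simp: Pair_vimage_Sigma)
    qed
    also have "\<dots> = emeasure (M \<bind> ?\<kappa>) R"
      using emeasure_bind[OF not_empty \<kappa>, of R] by (simp add: R)
    finally show "emeasure ?P R = emeasure (M \<bind> ?\<kappa>) R" .
  next
    show "sets (M \<bind> ?\<kappa>) = sigma_sets (space S \<times> space borel)
        {a \<times> b |a b. a \<in> sets S \<and> b \<in> sets (borel :: real measure)}"
      by (rule trans[OF sets_bind[of M ?\<kappa> "S \<Otimes>\<^sub>M borel"] sets_pair_measure[of S borel]])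
        (use sets_kernel[OF \<kappa>] not_empty in blast)+
    show "range (\<lambda>_. space S \<times> (UNIV :: real set))
        \<subseteq> {a \<times> b |a b. a \<in> sets S \<and> b \<in> sets (borel :: real measure)}"
      by (rule image_subsetI, rule CollectI, rule exI[of _ "space S"], rule exI[of _ UNIV]) simp
    show "sets ?P = sigma_sets (space S \<times> space borel)
        {a \<times> b |a b. a \<in> sets S \<and> b \<in> sets (borel :: real measure)}"
      by (simp add: sets_pair_measure)
    show "(\<Union>i::nat. space S \<times> (UNIV :: real set)) = space S \<times> space borel" by simp
    show "emeasure ?P (space S \<times> UNIV) \<noteq> \<infinity>" by (simp only: P.emeasure_eq_measure) simp
  qed
  moreover have "(\<integral>p. (\<lambda>(x, y). h x y) p \<partial>?P) = (\<integral>\<omega>. h (U \<omega>) (X (Suc s) \<omega>) \<partial>M)"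
    using h by (subst integral_distr) auto
  ultimately show ?thesis
    by (metis integral_bind_pair[OF prob_space_axioms U' \<pi> h bound])
qed

section \<open>Convergence of the normalised kernels\<close>

lemma AE_half_line:
  assumes "real_distribution L" "measure L {0..} = 1"
  shows "AE y in L. 0 \<le> y"
proof -
  interpret real_distribution L by fact
  have "prob {y \<in> space L. 0 \<le> y} = 1"
    using assms(2) by (simp add: atLeast_def)
  then show ?thesis by (subst (asm) prob_Collect_eq_1) auto
qed

text \<open>A continuous function on the line restricts to a test function on the half-line, and
  full mass there makes the restricted integrals agree with those over the line. The result is
  \<open>weak_conv_m\<close>, the form that Skorohod representation takes.\<close>

lemma half_line_weak_conv:
  assumes conv: "weakly_converges half_line N L at_top"
    and x: "filterlim x at_top sequentially"
    and N: "\<And>n. real_distribution (N (x n))" "\<And>n. AE y in N (x n). 0 \<le> y"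
    and L: "real_distribution L" "AE y in L. 0 \<le> y"
  shows "weak_conv_m (\<lambda>n. N (x n)) L"
proof (rule integral_bdd_continuous_conv_imp_weak_conv[OF N(1) L(1)])
  fix f :: "real \<Rightarrow> real"
  assume f: "\<And>y. isCont f y" "\<And>y. \<bar>f y\<bar> \<le> 1"
  then have cont: "continuous_on UNIV f"
    by (simp add: continuous_at_imp_continuous_on)
  then have f_meas [measurable]: "f \<in> borel_measurable borel"
    by (rule borel_measurable_continuous_onI)
  have "continuous_map half_line euclideanreal f"
    using cont continuous_on_subset by auto
  moreover have "bounded (f ` topspace half_line)"
    using f(2) by (auto simp: bounded_iff)
  ultimately have lim: "((\<lambda>u. LINT y:{0..}|N u. f y) \<longlongrightarrow> (LINT y:{0..}|L. f y)) at_top"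
    using conv by (simp add: weakly_converges_def)
  have eq: "(LINT y:{0..}|P. f y) = (\<integral>y. f y \<partial>P)" if "real_distribution P" "AE y in P. 0 \<le> y" for P
  proof -
    interpret real_distribution P by fact
    show ?thesis
      unfolding set_lebesgue_integral_def using that(2) by (intro integral_cong_AE) auto
  qed
  show "(\<lambda>n. \<integral>y. f y \<partial>N (x n)) \<longlonglongrightarrow> (\<integral>y. f y \<partial>L)"
    using filterlim_compose[OF lim x] by (simp add: eq N L)
qed

text \<open>
  The state of the chain at time \<open>s\<close> given \<open>X 0 > u\<close> is the path of normalised values, so the initial
  value is \<open>u + \<sigma> u * z 0\<close>. Absolute values keep all arguments of \<open>\<pi>\<close> and \<open>bs\<close> in the
  half-line, where they are specified.
\<close>

definition start :: "(real \<Rightarrow> real) \<Rightarrow> real \<Rightarrow> (nat \<Rightarrow> real) \<Rightarrow> real" where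
  "start \<sigma> u z = \<bar>u\<bar> + \<bar>\<sigma> u\<bar> * \<bar>z 0\<bar>"

definition position ::
  "(real \<Rightarrow> real) \<Rightarrow> (nat \<Rightarrow> real \<Rightarrow> real) \<Rightarrow> real \<Rightarrow> nat \<Rightarrow> (nat \<Rightarrow> real) \<Rightarrow> real" where
  "position \<sigma> bs u s z = (if s = 0 then start \<sigma> u z else bs s (start \<sigma> u z) * \<bar>z s\<bar>)"

definition chain_kernel ::
  "(real \<Rightarrow> real measure) \<Rightarrow> (real \<Rightarrow> real) \<Rightarrow> (nat \<Rightarrow> real \<Rightarrow> real) \<Rightarrow>
   real \<Rightarrow> nat \<Rightarrow> (nat \<Rightarrow> real) \<Rightarrow> real measure" where
  "chain_kernel \<pi> \<sigma> bs u s z =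
     distr (\<pi> (position \<sigma> bs u s z)) borel (\<lambda>y. y / bs (Suc s) (start \<sigma> u z))"

text \<open>
  The value 1 at \<open>s = 0\<close> treats \<open>Y 1\<close> as one more innovation; at nonpositive \<open>z s\<close> it only
  serves measurability.
\<close>

definition growth :: "(nat \<Rightarrow> real \<Rightarrow> real) \<Rightarrow> nat \<Rightarrow> (nat \<Rightarrow> real) \<Rightarrow> real" where
  "growth \<psi> s z = (if s = 0 \<or> z s \<le> 0 then 1 else \<psi> s (z s))"

definition limit_kernel ::
  "real measure \<Rightarrow> (nat \<Rightarrow> real \<Rightarrow> real) \<Rightarrow> nat \<Rightarrow> (nat \<Rightarrow> real) \<Rightarrow> real measure" where
  "limit_kernel K \<psi> s z = distr K borel (\<lambda>y. growth \<psi> s z * y)"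

lemma start_nonneg: "0 \<le> start \<sigma> u z"
  by (simp add: start_def)

lemma start_ge: "u \<le> start \<sigma> u z"
  using abs_ge_self[of u] mult_nonneg_nonneg[of "\<bar>\<sigma> u\<bar>" "\<bar>z 0\<bar>"]
  unfolding start_def by linarith

lemma start_measurable [measurable]: "start \<sigma> u \<in> borel_measurable borel"
  unfolding start_def by measurable

lemma positive_measurable_start:
  assumes "positive_measurable g"
  shows "(\<lambda>z. g (start \<sigma> u z)) \<in> borel_measurable borel" "0 < g (start \<sigma> u z)"
proof -
  have "start \<sigma> u \<in> borel \<rightarrow>\<^sub>M restrict_space borel {0..}"
    by (intro measurable_restrict_space2) (auto simp: start_nonneg)
  then show "(\<lambda>z. g (start \<sigma> u z)) \<in> borel_measurable borel"
    by (rule measurable_compose) (use assms in \<open>simp add: positive_measurable_def\<close>)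
  show "0 < g (start \<sigma> u z)"
    using assms start_nonneg by (simp add: positive_measurable_def)
qed

lemma position_kernel:
  assumes bs: "\<And>s. 1 \<le> s \<Longrightarrow> positive_measurable (bs s)"
  shows "position \<sigma> bs u s \<in> borel \<rightarrow>\<^sub>M restrict_space borel {0..}"
proof (intro measurable_restrict_space2)
  show "position \<sigma> bs u s \<in> borel_measurable borel"
  proof (cases "s = 0")
    case False
    then have [measurable]: "(\<lambda>z. bs s (start \<sigma> u z)) \<in> borel_measurable borel"
      using bs by (intro positive_measurable_start) simp
    show ?thesis using False by (simp add: position_def[abs_def])
  qed (simp add: position_def[abs_def])
  show "position \<sigma> bs u s \<in> space borel \<rightarrow> {0..}"
    using positive_measurable_start(2)[OF bs, of s \<sigma> u]
    by (auto simp: position_def start_nonneg less_imp_le)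
qed

lemma chain_kernel_measurable:
  assumes \<pi>: "half_line_kernel \<pi>" and bs: "\<And>s. 1 \<le> s \<Longrightarrow> positive_measurable (bs s)"
  shows "chain_kernel \<pi> \<sigma> bs u s \<in> borel \<rightarrow>\<^sub>M prob_algebra borel"
  unfolding chain_kernel_def
proof (rule measurable_distr_prob_space2)
  show "(\<lambda>z. \<pi> (position \<sigma> bs u s z)) \<in> borel \<rightarrow>\<^sub>M prob_algebra borel"
    by (rule measurable_compose[OF position_kernel[OF bs]]) (use \<pi> in \<open>simp_all add: half_line_kernel_def\<close>)
  have [measurable]: "(\<lambda>z. bs (Suc s) (start \<sigma> u z)) \<in> borel_measurable borel"
    using bs by (intro positive_measurable_start) simp
  show "(\<lambda>(z, y). y / bs (Suc s) (start \<sigma> u z)) \<in> borel_measurable (borel \<Otimes>\<^sub>M borel)"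
    by measurable
qed

lemma growth_measurable:
  assumes \<psi>: "\<And>s. 1 \<le> s \<Longrightarrow> continuous_on {0<..} (\<psi> s)"
  shows "growth \<psi> s \<in> borel_measurable borel"
proof (cases "s = 0")
  case False
  \<comment> \<open>\<open>\<psi> s\<close> is continuous on the open half-line and arbitrary
    elsewhere, so it is cut off before measurability is claimed.\<close>
  then have [measurable]: "(\<lambda>x. indicator {0<..} x *\<^sub>R \<psi> s x) \<in> borel_measurable borel"
    using \<psi> by (intro borel_measurable_continuous_on_indicator) auto
  have "(\<lambda>z. indicator {0<..} (z s) *\<^sub>R \<psi> s (z s) + indicator {..0} (z s)) \<in> borel_measurable borel"
    by (rule measurable_compose[OF measurable_product_coordinates]) measurable
  moreover have "growth \<psi> s = (\<lambda>z. indicator {0<..} (z s) *\<^sub>R \<psi> s (z s) + indicator {..0} (z s))"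
    using False by (auto simp: growth_def fun_eq_iff split: split_indicator)
  ultimately show ?thesis by simp
qed (simp add: growth_def[abs_def])

lemma limit_kernel_measurable:
  assumes K: "real_distribution K" and \<psi>: "\<And>s. 1 \<le> s \<Longrightarrow> continuous_on {0<..} (\<psi> s)"
  shows "limit_kernel K \<psi> s \<in> borel \<rightarrow>\<^sub>M prob_algebra borel"
  unfolding limit_kernel_def
proof (rule measurable_distr_prob_space2)
  interpret real_distribution K by fact
  show "(\<lambda>_. K) \<in> borel \<rightarrow>\<^sub>M prob_algebra borel"
    by (rule measurable_const) (simp add: space_prob_algebra prob_space_axioms)
  have [measurable]: "growth \<psi> s \<in> borel_measurable borel" by (rule growth_measurable[OF \<psi>])
  show "(\<lambda>(z, y). growth \<psi> s z * y) \<in> borel_measurable (borel \<Otimes>\<^sub>M borel)"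
    by measurable
qed

lemma growth_pos:
  assumes "assumption_B2 b bs \<psi>"
  shows "0 < growth \<psi> s z"
  using assms by (auto simp: growth_def assumption_B2_def)

lemma AE_pos_K:
  assumes "assumption_B1 \<pi> b K"
  shows "AE y in K. 0 < y"
proof -
  interpret real_distribution K
    using assms by (simp add: assumption_B1_def half_line_distribution_def)
  have "AE y in K. 0 \<le> y"
    using assms by (intro AE_half_line) (auto simp: assumption_B1_def half_line_distribution_def)
  moreover have "AE y in K. y \<notin> {0}"
    using assms by (intro AE_not_in) (simp add: assumption_B1_def null_sets_def emeasure_eq_measure)
  ultimately show ?thesis by eventually_elim simp
qed

text \<open>Both arguments move with \<open>n\<close>, so the pointwise limit defining
  \<open>\<psi> s\<close> does not suffice. Solving the definition of the remainder for the ratio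
  gives \<open>\<psi> s x / (1 - remainder)\<close>; uniformity controls the remainder and
  continuity the numerator.\<close>

lemma growth_ratio_tendsto:
  assumes B2: "assumption_B2 b bs \<psi>" and b: "positive_measurable b"
    and v: "filterlim v at_top sequentially" "\<And>n. 0 \<le> v n"
    and x: "x \<longlonglongrightarrow> c" "0 < c" and s: "1 \<le> s"
  shows "(\<lambda>n. b (bs s (v n) * \<bar>x n\<bar>) / bs (Suc s) (v n)) \<longlonglongrightarrow> \<psi> s c"
proof -
  \<comment> \<open>A compact neighbourhood of \<open>c\<close> bounded away from 0, as B2 gives
    uniformity on such sets. It also makes \<open>x n\<close> eventually positive, so the absolute
    value disappears.\<close>
  have ev: "eventually (\<lambda>n. x n \<in> {c/2..2*c}) sequentially"
    using order_tendstoD[OF x(1), of "c/2"] order_tendstoD[OF x(1), of "2*c"] x(2)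
    by (auto elim: eventually_elim2)
  have bs_pos: "0 < bs r (v n)" if "1 \<le> r" for r n
    using B2 that v(2) by (auto simp: assumption_B2_def positive_measurable_def)
  have "uniform_limit {c/2..2*c} (remainder b bs \<psi> s) (\<lambda>_. 0) at_top"
    using B2 s x(2) unfolding assumption_B2_def
    by (meson atLeastAtMost_iff atLeast_iff compact_Icc half_gt_zero subsetI)
  then have "(\<lambda>n. remainder b bs \<psi> s (v n) (x n)) \<longlonglongrightarrow> 0"
    unfolding tendsto_iff uniform_limit_iff
  proof (intro allI impI)
    fix e :: real assume "0 < e"
      and *: "\<forall>e>0. \<forall>\<^sub>F n in at_top. \<forall>x\<in>{c/2..2*c}. dist (remainder b bs \<psi> s n x) 0 < e"
    then have "\<forall>\<^sub>F n in at_top. \<forall>x\<in>{c/2..2*c}. dist (remainder b bs \<psi> s n x) 0 < e" by blast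
    from eventually_compose_filterlim[OF this v(1)] ev
    show "\<forall>\<^sub>F n in sequentially. dist (remainder b bs \<psi> s (v n) (x n)) 0 < e"
      by eventually_elim blast
  qed
  moreover have "(\<lambda>n. \<psi> s (x n)) \<longlonglongrightarrow> \<psi> s c"
    using B2 s x ev by (intro continuous_on_tendsto_compose[of "{0<..}" "\<psi> s"])
      (auto simp: assumption_B2_def elim!: eventually_mono)
  ultimately have "(\<lambda>n. \<psi> s (x n) / (1 - remainder b bs \<psi> s (v n) (x n))) \<longlonglongrightarrow> \<psi> s c / (1 - 0)"
    by (intro tendsto_intros) auto
  moreover have "eventually (\<lambda>n. \<psi> s (x n) / (1 - remainder b bs \<psi> s (v n) (x n))
      = b (bs s (v n) * \<bar>x n\<bar>) / bs (Suc s) (v n)) sequentially"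
    using ev
  proof eventually_elim
    case (elim n)
    then have xn: "0 < x n" using x(2) by auto
    then have "0 < \<psi> s (x n)" using B2 s by (auto simp: assumption_B2_def)
    moreover have "0 < b (bs s (v n) * x n)"
      using b bs_pos[OF s] xn by (auto simp: positive_measurable_def less_imp_le)
    ultimately show ?case
      using xn bs_pos[of "Suc s" n] by (simp add: remainder_def field_simps)
  qed
  ultimately show ?thesis by (simp add: tendsto_cong)
qed

text \<open>A Slutsky argument: the next normalised value is \<open>r n\<close> times the next value
  divided by \<open>b (x n)\<close>. The latter converges weakly by B1 once the current position
  \<open>x n\<close> tends to infinity, and the deterministic ratio \<open>r n\<close> of the two
  normalisations converges by B2.\<close>

lemma chain_kernel_weak_conv:
  assumes \<pi>: "half_line_kernel \<pi>" and B1: "assumption_B1 \<pi> b K" and B2: "assumption_B2 b bs \<psi>"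
    and u: "filterlim u at_top sequentially" and z: "zs \<longlonglongrightarrow> z" "\<forall>i\<in>{1..s}. 0 < z i"
  shows "weak_conv_m (\<lambda>n. chain_kernel \<pi> \<sigma> bs (u n) s (zs n)) (limit_kernel K \<psi> s z)"
proof -
  define v where "v n = start \<sigma> (u n) (zs n)" for n
  define x where "x n = position \<sigma> bs (u n) s (zs n)" for n
  define r where "r n = b (x n) / bs (Suc s) (v n)" for n
  have b: "positive_measurable b" and K: "real_distribution K" "AE y in K. 0 < y"
    using B1 AE_pos_K[OF B1] by (auto simp: assumption_B1_def half_line_distribution_def)
  have bs: "1 \<le> s \<Longrightarrow> positive_measurable (bs s)" and bs1: "bs 1 = b" for s
    using B2 by (auto simp: assumption_B2_def)
  have \<psi>: "1 \<le> s \<Longrightarrow> continuous_on {0<..} (\<psi> s)" for s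
    using B2 by (auto simp: assumption_B2_def)
  have v: "filterlim v at_top sequentially" "\<And>n. 0 \<le> v n"
    by (rule filterlim_at_top_mono[OF u]) (simp_all add: v_def start_ge start_nonneg)
  have zs: "(\<lambda>n. zs n s) \<longlonglongrightarrow> z s"
    using z(1) by (simp add: tendsto_fun_iff)
  \<comment> \<open>After time 0 this rests on \<open>0 < z s\<close>: the normaliser tends to
    infinity and is multiplied by a factor with positive limit.\<close>
  have x: "filterlim x at_top sequentially"
  proof (cases "s = 0")
    case False
    then have "0 < z s" using z(2) by simp
    with False have "filterlim (\<lambda>n. \<bar>zs n s\<bar> * bs s (v n)) at_top sequentially"
      using B2
      by (intro filterlim_tendsto_pos_mult_at_top[OF tendsto_rabs[OF zs]] filterlim_compose[OF _ v(1)])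
        (auto simp: assumption_B2_def)
    then show ?thesis using False by (simp add: x_def[abs_def] position_def v_def mult.commute)
  qed (use v(1) in \<open>simp add: x_def[abs_def] position_def v_def[abs_def]\<close>)
  have x_nonneg: "0 \<le> x n" for n
  proof -
    have "position \<sigma> bs (u n) s \<in> borel \<rightarrow>\<^sub>M restrict_space borel {0..}"
      by (rule position_kernel[OF bs])
    from measurable_space[OF this, of "zs n"] show ?thesis by (simp add: x_def)
  qed
  have b_pos: "0 < b (x n)" for n using b x_nonneg by (simp add: positive_measurable_def)
  \<comment> \<open>At time 0 position and initial value coincide and \<open>bs 1 = b\<close>, so
    the ratio is exactly 1, the value of \<open>growth\<close> there. Later it is the ratio in
    B2.\<close>
  have r: "r \<longlonglongrightarrow> growth \<psi> s z"
  proof (cases "s = 0")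
    case True
    then have "r = (\<lambda>_. 1)"
      using bs1 b v(2) by (auto simp: r_def x_def position_def v_def fun_eq_iff positive_measurable_def)
        (metis less_irrefl start_nonneg)
    then show ?thesis using True by (simp add: growth_def)
  next
    case False
    then have "r = (\<lambda>n. b (bs s (v n) * \<bar>zs n s\<bar>) / bs (Suc s) (v n))"
      by (simp add: r_def[abs_def] x_def position_def v_def)
    moreover have "0 < z s" using False z(2) by simp
    moreover from this have "growth \<psi> s z = \<psi> s (z s)" using False by (simp add: growth_def)
    ultimately show ?thesis
      using growth_ratio_tendsto[OF B2 b v zs] False by simp
  qed
  have \<pi>x: "real_distribution (\<pi> (x n))" for n
    using \<pi> x_nonneg[of n] unfolding half_line_kernel_def
    by (intro prob_algebra_kernelD[of \<pi> "restrict_space borel {0..}"]) (auto simp: space_restrict_space)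
  let ?\<mu> = "\<lambda>n. distr (\<pi> (x n)) borel (\<lambda>y. y / b (x n))"
  have \<mu>: "real_distribution (?\<mu> n)" for n
  proof -
    interpret real_distribution "\<pi> (x n)" by (rule \<pi>x)
    show ?thesis by (rule real_distribution_distr) simp
  qed
  have \<mu>_conv: "weak_conv_m ?\<mu> K"
  proof (rule half_line_weak_conv[where N="\<lambda>v. distr (\<pi> v) borel (\<lambda>z. z / b v)", OF _ x \<mu> _ K(1)])
    show "weakly_converges half_line (\<lambda>v. distr (\<pi> v) borel (\<lambda>z. z / b v)) K at_top"
      using B1 by (simp add: assumption_B1_def)
    show "AE y in K. 0 \<le> y" using K(2) by eventually_elim simp
    fix n
    interpret real_distribution "\<pi> (x n)" by (rule \<pi>x)
    have "AE y in \<pi> (x n). 0 \<le> y"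
      using \<pi> x_nonneg[of n] by (intro AE_half_line \<pi>x) (simp add: half_line_kernel_def)
    then have "AE y in \<pi> (x n). 0 \<le> y / b (x n)"
      by eventually_elim (use b_pos in \<open>simp add: less_imp_le\<close>)
    then show "AE y in ?\<mu> n. 0 \<le> y"
      by (subst AE_distr_iff) auto
  qed
  have chain: "real_distribution (chain_kernel \<pi> \<sigma> bs (u n) s (zs n))" for n
    by (rule prob_algebra_kernelD[OF chain_kernel_measurable[OF \<pi> bs]]) auto
  have limit: "real_distribution (limit_kernel K \<psi> s z)"
    by (rule prob_algebra_kernelD[OF limit_kernel_measurable[OF K(1) \<psi>]]) auto
  show ?thesis
  proof (rule integral_bdd_continuous_conv_imp_weak_conv[OF chain limit])
    fix f :: "real \<Rightarrow> real"
    assume f: "\<And>y. isCont f y" "\<And>y. \<bar>f y\<bar> \<le> 1"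
    then have [measurable]: "f \<in> borel_measurable borel"
      by (intro borel_measurable_continuous_onI continuous_at_imp_continuous_on) auto
    have "(\<lambda>n. \<integral>y. f (r n * y) \<partial>?\<mu> n) \<longlonglongrightarrow> (\<integral>y. f (growth \<psi> s z * y) \<partial>K)"
    proof (rule extended_continuous_mapping[OF \<mu> K(1) \<mu>_conv, where P="\<lambda>_. True" and B=1])
      fix y ys assume "ys \<longlonglongrightarrow> (y::real)"
      then show "(\<lambda>n. f (r n * ys n)) \<longlonglongrightarrow> f (growth \<psi> s z * y)"
        using r by (intro isCont_tendsto_compose[OF f(1)] tendsto_mult)
    qed (use f(2) in auto)
    moreover have "(\<integral>y. f y \<partial>chain_kernel \<pi> \<sigma> bs (u n) s (zs n)) = (\<integral>y. f (r n * y) \<partial>?\<mu> n)" for n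
    proof -
      interpret real_distribution "\<pi> (x n)" by (rule \<pi>x)
      show ?thesis
        using b_pos[of n] unfolding chain_kernel_def
        by (subst (1 2) integral_distr) (auto simp: r_def simp flip: x_def v_def)
    qed
    moreover have "(\<integral>y. f y \<partial>limit_kernel K \<psi> s z) = (\<integral>y. f (growth \<psi> s z * y) \<partial>K)"
    proof -
      interpret real_distribution K by (rule K)
      show ?thesis unfolding limit_kernel_def by (subst integral_distr) auto
    qed
    ultimately show "(\<lambda>n. \<integral>y. f y \<partial>chain_kernel \<pi> \<sigma> bs (u n) s (zs n)) \<longlonglongrightarrow> (\<integral>y. f y \<partial>limit_kernel K \<psi> s z)"
      by simp
  qed
qed

section \<open>The normalised chain above a high threshold\<close>

lemma integral_uniform_measure:
  fixes f :: "'a \<Rightarrow> real"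
  assumes M: "finite_measure M" and A: "A \<in> sets M" "measure M A \<noteq> 0"
    and f: "f \<in> borel_measurable M"
  shows "(\<integral>x. f x \<partial>uniform_measure M A) = (\<integral>x. indicator A x * f x \<partial>M) / measure M A"
proof -
  interpret finite_measure M by fact
  have "0 < measure M A"
    using A(2) by (simp add: zero_less_measure_iff)
  then have "uniform_measure M A = density M (\<lambda>x. ennreal (indicator A x / measure M A))"
    unfolding uniform_measure_def emeasure_eq_measure
    by (intro arg_cong[of _ _ "density M"]) (auto simp: fun_eq_iff divide_ennreal split: split_indicator
        simp flip: ennreal_1)
  then show ?thesis
    using A f by (simp add: integral_density)
qed

definition chain_path ::
  "(nat \<Rightarrow> 'w \<Rightarrow> real) \<Rightarrow> (real \<Rightarrow> real) \<Rightarrow> (nat \<Rightarrow> real \<Rightarrow> real) \<Rightarrow> real \<Rightarrow> nat \<Rightarrow> 'w \<Rightarrow> nat \<Rightarrow> real"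
  where
  "chain_path X \<sigma> bs u s \<omega> =
     (\<lambda>k. if k = 0 then (X 0 \<omega> - u) / \<sigma> u else if k \<le> s then X k \<omega> / bs k (X 0 \<omega>) else 0)"

lemma chain_path_Suc:
  "chain_path X \<sigma> bs u (Suc s) \<omega> = (chain_path X \<sigma> bs u s \<omega>)(Suc s := X (Suc s) \<omega> / bs (Suc s) (X 0 \<omega>))"
  by (auto simp: chain_path_def fun_eq_iff)

text \<open>Measurability is relative to the history, not just to \<open>M\<close>, because the path
  is the past variable \<open>U\<close> inserted into the Markov property.\<close>

lemma chain_path_measurable:
  assumes mc: "markov_chain M X F \<pi>" and bs: "\<And>s. 1 \<le> s \<Longrightarrow> positive_measurable (bs s)"
  shows "chain_path X \<sigma> bs u s \<in> borel_measurable (history M X s)"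
  unfolding chain_path_def
proof (rule measurable_coordinatewise_then_product)
  have X [measurable]: "X k \<in> borel_measurable (history M X s)" if "k \<le> s" for k
  proof -
    have "(\<lambda>\<omega>. \<lambda>s\<in>{0..s}. X s \<omega>) \<in> history M X s \<rightarrow>\<^sub>M Pi\<^sub>M {0..s} (\<lambda>_. borel)"
      unfolding history_def by (rule measurable_vimage_algebra1) (auto simp: space_PiM)
    from measurable_compose[OF this measurable_component_singleton, of k] that
    show ?thesis by simp
  qed
  have "X 0 \<in> history M X s \<rightarrow>\<^sub>M restrict_space borel {0..}"
    using X[of 0] mc by (intro measurable_restrict_space2) (auto simp: markov_chain_def history_def)
  then have bs' [measurable]: "(\<lambda>\<omega>. bs k (X 0 \<omega>)) \<in> borel_measurable (history M X s)" if "1 \<le> k" for k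
    by (rule measurable_compose) (use bs[OF that] in \<open>simp add: positive_measurable_def\<close>)
  fix k
  show "(\<lambda>\<omega>. if k = 0 then (X 0 \<omega> - u) / \<sigma> u else if k \<le> s then X k \<omega> / bs k (X 0 \<omega>) else 0)
    \<in> borel_measurable (history M X s)"
    using X[of 0] X[of k] bs'[of k] by (cases "k = 0"; cases "k \<le> s") auto
qed

text \<open>Above a positive threshold the excess is positive, so the absolute values in
  \<open>start\<close> and \<open>position\<close> act trivially and the normalisation is undone
  exactly.\<close>

lemma chain_path_state:
  assumes mc: "markov_chain M X F \<pi>" and bs: "\<And>s. 1 \<le> s \<Longrightarrow> positive_measurable (bs s)"
    and u: "0 < u" "0 < \<sigma> u" and \<omega>: "\<omega> \<in> space M" "u < X 0 \<omega>"
  shows "start \<sigma> u (chain_path X \<sigma> bs u s \<omega>) = X 0 \<omega>"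
    and "position \<sigma> bs u s (chain_path X \<sigma> bs u s \<omega>) = X s \<omega>"
proof -
  show start: "start \<sigma> u (chain_path X \<sigma> bs u s \<omega>) = X 0 \<omega>"
    using u \<omega>(2) by (simp add: start_def chain_path_def)
  have "0 < bs s (X 0 \<omega>)" if "s \<noteq> 0"
    using bs[of s] that u \<omega>(2) by (simp add: positive_measurable_def)
  moreover have "0 \<le> X s \<omega>" using mc \<omega>(1) by (simp add: markov_chain_def)
  ultimately show "position \<sigma> bs u s (chain_path X \<sigma> bs u s \<omega>) = X s \<omega>"
    using start by (auto simp: position_def chain_path_def)
qed

text \<open>Conditioning survives the Markov step because \<open>A\<close> is decided by the initial
  value: its indicator factors out of the inner integral, and division by its mass affects both
  sides alike.\<close>

lemma chain_path_step:
  assumes mc: "markov_chain M X F \<pi>" and bs: "\<And>s. 1 \<le> s \<Longrightarrow> positive_measurable (bs s)"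
    and u: "0 < u" "0 < \<sigma> u" and A: "A = {\<omega> \<in> space M. u < X 0 \<omega>}" "measure M A \<noteq> 0"
    and h: "h \<in> borel_measurable borel" and bound: "\<And>z. \<bar>h z\<bar> \<le> (B::real)"
  shows "(\<integral>\<omega>. h (chain_path X \<sigma> bs u (Suc s) \<omega>) \<partial>uniform_measure M A)
    = (\<integral>\<omega>. (\<integral>y. h ((chain_path X \<sigma> bs u s \<omega>)(Suc s := y))
          \<partial>chain_kernel \<pi> \<sigma> bs u s (chain_path X \<sigma> bs u s \<omega>)) \<partial>uniform_measure M A)"
proof -
  interpret prob_space M using mc by (simp add: markov_chain_def)
  have X [measurable]: "X t \<in> borel_measurable M" for t
    using mc by (simp add: markov_chain_def)
  have \<pi>: "half_line_kernel \<pi>" using mc by (simp add: markov_chain_def)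
  have A_sets [measurable]: "A \<in> sets M" unfolding A by measurable
  let ?P = "chain_path X \<sigma> bs u"
  have P [measurable]: "?P s \<in> borel_measurable M" for s
    using chain_path_measurable[OF mc bs] by (rule measurable_from_subalg[OF subalgebra_history[OF X]])
  have [measurable]: "(\<lambda>z. bs (Suc s) (start \<sigma> u z)) \<in> borel_measurable borel"
    using bs by (intro positive_measurable_start) simp
  note [measurable] = h
  \<comment> \<open>Coordinate 0 of the path is positive exactly on \<open>A\<close>, so the
    indicator of \<open>A\<close> becomes a function of the path. The normalisation of the next
    value is absorbed into \<open>h'\<close>, so that the raw law \<open>\<pi>\<close> can act on
    it.\<close>
  define h' where "h' z y = indicat_real {0<..} (z 0) * h (z(Suc s := y / bs (Suc s) (start \<sigma> u z)))"
    for z :: "nat \<Rightarrow> real" and y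
  have [measurable]: "(\<lambda>z. z 0) \<in> borel_measurable (borel :: (nat \<Rightarrow> real) measure)"
    by (rule measurable_product_coordinates)
  have h'_meas: "(\<lambda>(z, y). h' z y) \<in> borel_measurable (borel \<Otimes>\<^sub>M borel)"
    unfolding h'_def by measurable
  have B: "0 \<le> B" using bound[of undefined] by linarith
  have h'_bound: "\<bar>h' z y\<bar> \<le> B" for z y
    using bound B by (auto simp: h'_def split: split_indicator)
  have "?P s \<omega> 0 = (X 0 \<omega> - u) / \<sigma> u" for s \<omega> by (simp add: chain_path_def)
  then have ind: "indicat_real {0<..} (?P s \<omega> 0) = indicator A \<omega>" if "\<omega> \<in> space M" for s \<omega>
    using u that by (auto simp: A zero_less_divide_iff split: split_indicator)
  have "(\<integral>\<omega>. indicator A \<omega> * h (?P (Suc s) \<omega>) \<partial>M) = (\<integral>\<omega>. h' (?P s \<omega>) (X (Suc s) \<omega>) \<partial>M)"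
  proof (rule Bochner_Integration.integral_cong[OF refl])
    fix \<omega> assume \<omega>: "\<omega> \<in> space M"
    show "indicator A \<omega> * h (?P (Suc s) \<omega>) = h' (?P s \<omega>) (X (Suc s) \<omega>)"
      using chain_path_state(1)[where s=s and \<sigma>=\<sigma>, OF mc bs u \<omega>]
      by (auto simp: h'_def ind[OF \<omega>] chain_path_Suc A split: split_indicator)
  qed
  also have "\<dots> = (\<integral>\<omega>. (\<integral>y. h' (?P s \<omega>) y \<partial>\<pi> (X s \<omega>)) \<partial>M)"
    by (rule markov_chain_transition[OF mc chain_path_measurable[OF mc bs] h'_meas h'_bound]) auto
  also have "\<dots> = (\<integral>\<omega>. indicator A \<omega> *
      (\<integral>y. h ((?P s \<omega>)(Suc s := y)) \<partial>chain_kernel \<pi> \<sigma> bs u s (?P s \<omega>)) \<partial>M)"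
  proof (rule Bochner_Integration.integral_cong[OF refl])
    fix \<omega> assume \<omega>: "\<omega> \<in> space M"
    interpret \<pi>: real_distribution "\<pi> (X s \<omega>)"
      by (rule prob_algebra_kernelD[OF markov_chain_kernel[OF mc] \<omega>])
    show "(\<integral>y. h' (?P s \<omega>) y \<partial>\<pi> (X s \<omega>)) = indicator A \<omega> *
      (\<integral>y. h ((?P s \<omega>)(Suc s := y)) \<partial>chain_kernel \<pi> \<sigma> bs u s (?P s \<omega>))"
    \<comment> \<open>Off \<open>A\<close> the path need not encode the position, but both sides
      vanish there.\<close>
    proof (cases "\<omega> \<in> A")
      case True
      then have "position \<sigma> bs u s (?P s \<omega>) = X s \<omega>"
        using chain_path_state(2)[where s=s and \<sigma>=\<sigma>, OF mc bs u \<omega>] by (simp add: A)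
      with True show ?thesis
        by (simp add: chain_kernel_def h'_def ind[OF \<omega>] integral_distr)
    qed (simp add: h'_def ind[OF \<omega>])
  qed
  finally have "(\<integral>\<omega>. indicator A \<omega> * h (?P (Suc s) \<omega>) \<partial>M) = (\<integral>\<omega>. indicator A \<omega> *
      (\<integral>y. h ((?P s \<omega>)(Suc s := y)) \<partial>chain_kernel \<pi> \<sigma> bs u s (?P s \<omega>)) \<partial>M)" .
  moreover have "(\<lambda>\<omega>. \<integral>y. h ((?P s \<omega>)(Suc s := y)) \<partial>chain_kernel \<pi> \<sigma> bs u s (?P s \<omega>)) \<in> borel_measurable M"
    by (rule integral_kernel_measurable[OF measurable_compose[OF P chain_kernel_measurable[OF \<pi> bs]]]) auto
  ultimately show ?thesis
    using A(2) by (simp add: integral_uniform_measure finite_measure_axioms)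
qed

section \<open>The tail chain\<close>

text \<open>Fubini, pulled back to one probability space with two copies of the sample point. The
  product law is a hypothesis, so that independence may enter as \<open>indep_var\<close> or as
  \<open>independent_variables\<close>.\<close>

lemma integral_product_law:
  fixes h :: "'a \<Rightarrow> 'b \<Rightarrow> real"
  assumes M: "prob_space M" and U: "U \<in> M \<rightarrow>\<^sub>M S" and V: "V \<in> M \<rightarrow>\<^sub>M T"
    and eq: "distr M S U \<Otimes>\<^sub>M distr M T V = distr M (S \<Otimes>\<^sub>M T) (\<lambda>\<omega>. (U \<omega>, V \<omega>))"
    and h: "(\<lambda>(x, y). h x y) \<in> borel_measurable (S \<Otimes>\<^sub>M T)" and bound: "\<And>x y. \<bar>h x y\<bar> \<le> B"
  shows "(\<integral>\<omega>. h (U \<omega>) (V \<omega>) \<partial>M) = (\<integral>\<omega>. (\<integral>\<omega>'. h (U \<omega>) (V \<omega>') \<partial>M) \<partial>M)"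
proof -
  interpret prob_space M by fact
  interpret U: prob_space "distr M S U" by (rule prob_space_distr[OF U])
  interpret V: prob_space "distr M T V" by (rule prob_space_distr[OF V])
  interpret UV: pair_prob_space "distr M S U" "distr M T V" ..
  have "\<bar>(\<lambda>(x, y). h x y) p\<bar> \<le> B" for p by (cases p) (simp add: bound)
  then have "integrable (distr M S U \<Otimes>\<^sub>M distr M T V) (\<lambda>(x, y). h x y)"
    using h by (intro UV.P.integrable_const_bound[where B=B]) auto
  from UV.integral_fst'[OF this]
  have "(\<integral>x. (\<integral>y. h x y \<partial>distr M T V) \<partial>distr M S U) = (\<integral>p. (\<lambda>(x, y). h x y) p \<partial>(distr M S U \<Otimes>\<^sub>M distr M T V))"
    by simp
  also have "\<dots> = (\<integral>\<omega>. h (U \<omega>) (V \<omega>) \<partial>M)"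
    unfolding eq using U V h by (subst integral_distr) auto
  finally have "(\<integral>\<omega>. h (U \<omega>) (V \<omega>) \<partial>M) = (\<integral>x. (\<integral>y. h x y \<partial>distr M T V) \<partial>distr M S U)" by simp
  also have "\<dots> = (\<integral>\<omega>. (\<integral>y. h (U \<omega>) y \<partial>distr M T V) \<partial>M)"
  proof (rule integral_distr[OF U])
    have "(\<lambda>(x, y). h x y) \<in> borel_measurable (S \<Otimes>\<^sub>M distr M T V)"
      using h by (simp cong: measurable_cong_sets sets_pair_measure_cong)
    then show "(\<lambda>x. \<integral>y. h x y \<partial>distr M T V) \<in> borel_measurable S"
      by (rule V.borel_measurable_lebesgue_integral)
  qed
  also have "\<dots> = (\<integral>\<omega>. (\<integral>\<omega>'. h (U \<omega>) (V \<omega>') \<partial>M) \<partial>M)"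
    using measurable_Pair2[OF h measurable_space[OF U]]
    by (intro Bochner_Integration.integral_cong refl integral_distr[OF V]) simp
  finally show ?thesis .
qed

lemma independent_variables_product_law:
  assumes M: "prob_space M" and ind: "independent_variables M S U T V"
  shows "distr M S U \<Otimes>\<^sub>M distr M T V = distr M (S \<Otimes>\<^sub>M T) (\<lambda>\<omega>. (U \<omega>, V \<omega>))"
proof -
  interpret prob_space M by fact
  have U [measurable]: "U \<in> M \<rightarrow>\<^sub>M S" and V [measurable]: "V \<in> M \<rightarrow>\<^sub>M T"
    using ind by (auto simp: independent_variables_def)
  interpret U: prob_space "distr M S U" by (rule prob_space_distr[OF U])
  interpret V: prob_space "distr M T V" by (rule prob_space_distr[OF V])
  show ?thesis
  proof (rule pair_measure_eqI)
    fix A B assume "A \<in> sets (distr M S U)" "B \<in> sets (distr M T V)"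
    then have AB [measurable]: "A \<in> sets S" "B \<in> sets T" by auto
    then have "prob ((U -` A \<inter> space M) \<inter> (V -` B \<inter> space M))
        = prob (U -` A \<inter> space M) * prob (V -` B \<inter> space M)"
      using ind unfolding independent_variables_def
      by (intro indep_setD[of "sets (vimage_algebra (space M) U S)" "sets (vimage_algebra (space M) V T)"])
        (auto intro: in_vimage_algebra)
    moreover have "(\<lambda>\<omega>. (U \<omega>, V \<omega>)) -` (A \<times> B) \<inter> space M = (U -` A \<inter> space M) \<inter> (V -` B \<inter> space M)"
      by auto
    ultimately show "emeasure (distr M S U) A * emeasure (distr M T V) B
        = emeasure (distr M (S \<Otimes>\<^sub>M T) (\<lambda>\<omega>. (U \<omega>, V \<omega>))) (A \<times> B)"
      by (simp add: emeasure_distr emeasure_eq_measure ennreal_mult)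
  qed (auto intro: U.sigma_finite_measure_axioms V.sigma_finite_measure_axioms)
qed

text \<open>Indexed so that innovation \<open>s\<close> drives the step from time \<open>s\<close> to time \<open>Suc s\<close>.\<close>

definition innovation :: "(nat \<Rightarrow> 'v \<Rightarrow> real) \<Rightarrow> (nat \<Rightarrow> 'v \<Rightarrow> real) \<Rightarrow> nat \<Rightarrow> 'v \<Rightarrow> real" where
  "innovation Y \<epsilon> i = (if i = 0 then Y 1 else \<epsilon> i)"

text \<open>Independence comes in two pieces, among the \<open>\<epsilon> s\<close> and of
  \<open>Y 1\<close> from their whole sequence. Splitting index 0 off a finite index set combines
  the two product formulas.\<close>

lemma innovation_indep_vars:
  assumes N: "prob_space N" and Y: "Y 1 \<in> borel_measurable N"
    and \<epsilon>: "prob_space.indep_vars N (\<lambda>_. borel) \<epsilon> {1..}"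
    and ind: "independent_variables N borel (Y 1)
        (Pi\<^sub>M {1..} (\<lambda>_. borel)) (\<lambda>\<omega>. \<lambda>s\<in>{1..}. \<epsilon> s \<omega>)"
  shows "prob_space.indep_vars N (\<lambda>_. borel) (innovation Y \<epsilon>) UNIV"
proof -
  interpret prob_space N by fact
  have \<epsilon>_meas: "\<epsilon> i \<in> borel_measurable N" if "1 \<le> i" for i
    using \<epsilon> that by (auto simp: indep_vars_def)
  have W: "innovation Y \<epsilon> i \<in> borel_measurable N" for i
    using Y \<epsilon>_meas[of i] by (auto simp: innovation_def)
  have "indep_sets (\<lambda>i. {innovation Y \<epsilon> i -` A \<inter> space N |A. A \<in> sets borel}) UNIV"
  proof (rule indep_setsI)
    show "{innovation Y \<epsilon> i -` A \<inter> space N |A. A \<in> sets borel} \<subseteq> events" for i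
      using measurable_sets[OF W] by auto
  next
    fix C :: "nat \<Rightarrow> 'a set" and J :: "nat set"
    assume J: "J \<noteq> {}" "finite J" and "\<forall>j\<in>J. C j \<in> {innovation Y \<epsilon> j -` A \<inter> space N |A. A \<in> sets borel}"
    then have "\<forall>j\<in>J. \<exists>A. A \<in> sets borel \<and> C j = innovation Y \<epsilon> j -` A \<inter> space N" by blast
    then obtain A where A: "\<And>j. j \<in> J \<Longrightarrow> A j \<in> sets borel"
      and C: "\<And>j. j \<in> J \<Longrightarrow> C j = innovation Y \<epsilon> j -` A j \<inter> space N" by metis
    define J' where "J' = J - {0}"
    have J': "finite J'" "J' \<subseteq> {1..}" using J by (auto simp: J'_def)
    have C': "C j = \<epsilon> j -` A j \<inter> space N" if "j \<in> J'" for j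
      using that C[of j] by (simp add: J'_def innovation_def)
    have tail: "prob (\<Inter>j\<in>J'. C j) = (\<Prod>j\<in>J'. prob (C j))" if "J' \<noteq> {}"
    proof -
      have "(\<Inter>j\<in>J'. C j) = (\<Inter>j\<in>J'. \<epsilon> j -` A j \<inter> space N)"
        using C' by (intro INF_cong) auto
      also have "prob \<dots> = (\<Prod>j\<in>J'. prob (\<epsilon> j -` A j \<inter> space N))"
        by (rule indep_varsD[OF \<epsilon> that J']) (auto simp: J'_def intro: A)
      finally show ?thesis using C' by (simp cong: prod.cong)
    qed
    show "prob (\<Inter>j\<in>J. C j) = (\<Prod>j\<in>J. prob (C j))"
    proof (cases "0 \<in> J")
      case False
      then show ?thesis using tail J by (simp add: J'_def)
    next
      case 0: True
      then have J_eq: "J = insert 0 J'" by (auto simp: J'_def)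
      show ?thesis
      proof (cases "J' = {}")
        case False
        \<comment> \<open>A cylinder in sequence space whose preimage is the finite intersection of
          \<open>\<epsilon>\<close>-events; in this form the independence from \<open>Y 1\<close>
          applies.\<close>
        let ?R = "{x \<in> space (Pi\<^sub>M {1..} (\<lambda>_. borel)). \<forall>j\<in>J'. x j \<in> A j}"
        let ?\<epsilon> = "\<lambda>\<omega>. \<lambda>s\<in>{1..}. \<epsilon> s \<omega>"
        have R: "?R \<in> sets (Pi\<^sub>M {1..} (\<lambda>_. borel))"
        proof (rule sets.sets_Collect_finite_All[OF _ J'(1)])
          fix j assume j: "j \<in> J'"
          then have "A j \<in> sets borel" using A by (simp add: J'_def)
          moreover have "(\<lambda>x. x j) \<in> Pi\<^sub>M {1..} (\<lambda>_. borel) \<rightarrow>\<^sub>M (borel :: real measure)"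
            using j J' by (intro measurable_component_singleton) auto
          ultimately show "{x \<in> space (Pi\<^sub>M {1..} (\<lambda>_. borel)). x j \<in> A j} \<in> sets (Pi\<^sub>M {1..} (\<lambda>_. borel))"
            by measurable
        qed
        have "(\<Inter>j\<in>J'. C j) = ?\<epsilon> -` ?R \<inter> space N"
          using False J'(2) by (auto simp: C' space_PiM)
        then have "(\<Inter>j\<in>J'. C j) \<in> sets (vimage_algebra (space N) ?\<epsilon> (Pi\<^sub>M {1..} (\<lambda>_. borel)))"
          by (simp only:) (rule in_vimage_algebra[OF R])
        moreover have "C 0 \<in> sets (vimage_algebra (space N) (Y 1) borel)"
          unfolding C[OF 0] innovation_def if_P[OF refl] by (rule in_vimage_algebra[OF A[OF 0]])
        ultimately have "prob (C 0 \<inter> (\<Inter>j\<in>J'. C j)) = prob (C 0) * prob (\<Inter>j\<in>J'. C j)"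
          using ind unfolding independent_variables_def by (blast intro: indep_setD)
        moreover have "0 \<notin> J'" by (simp add: J'_def)
        ultimately show ?thesis
          using tail[OF False] J'(1) by (simp add: J_eq)
      qed (simp add: J_eq)
    qed
  qed
  then show ?thesis using W by (simp add: indep_vars_def2)
qed

text \<open>The recursion solved as a deterministic map of the innovations. The excess
  \<open>e\<close> is a frozen parameter; its randomness enters later through independence.\<close>

primrec tail_path ::
  "(nat \<Rightarrow> real \<Rightarrow> real) \<Rightarrow> real \<Rightarrow> nat \<Rightarrow> (nat \<Rightarrow> real) \<Rightarrow> nat \<Rightarrow> real" where
  "tail_path \<psi> e 0 w = (\<lambda>_. 0)(0 := e)"
| "tail_path \<psi> e (Suc s) w = (tail_path \<psi> e s w)(Suc s := growth \<psi> s (tail_path \<psi> e s w) * w s)"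

lemma tail_path_cong: "(\<And>i. i < s \<Longrightarrow> w i = w' i) \<Longrightarrow> tail_path \<psi> e s w = tail_path \<psi> e s w'"
  by (induction s) auto

text \<open>The index set varies because the independence argument uses the innovations below
  \<open>s\<close>, and the path as a random variable uses the whole sequence.\<close>

lemma tail_path_measurable:
  assumes \<psi>: "\<And>s. 1 \<le> s \<Longrightarrow> continuous_on {0<..} (\<psi> s)" and "{..<s} \<subseteq> I"
  shows "tail_path \<psi> e s \<in> borel_measurable (Pi\<^sub>M I (\<lambda>_. borel))"
  using assms(2)
proof (induction s)
  case (Suc s)
  then have "{..<s} \<subseteq> I" by auto
  then have [measurable]: "tail_path \<psi> e s \<in> borel_measurable (Pi\<^sub>M I (\<lambda>_. borel))" by (rule Suc.IH)
  have [measurable]: "growth \<psi> s \<in> borel_measurable borel" by (rule growth_measurable[OF \<psi>])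
  have "s \<in> I" using Suc by auto
  then have [measurable]: "(\<lambda>w. w s) \<in> borel_measurable (Pi\<^sub>M I (\<lambda>_. borel))"
    by (rule measurable_component_singleton)
  show ?case unfolding tail_path.simps by measurable
qed (simp add: tail_path.simps(1)[abs_def])

text \<open>The state at time \<open>s\<close> is a function of the innovations below
  \<open>s\<close>, hence independent of innovation \<open>s\<close>. With the state frozen, scaling
  a variable of law \<open>K\<close> by \<open>growth\<close> is a draw from
  \<open>limit_kernel\<close>.\<close>

lemma tail_path_step:
  assumes N: "prob_space N" and ind: "prob_space.indep_vars N (\<lambda>_. borel) W UNIV"
    and W: "\<And>i. distr N borel (W i) = K"
    and \<psi>: "\<And>s. 1 \<le> s \<Longrightarrow> continuous_on {0<..} (\<psi> s)"
    and h: "h \<in> borel_measurable borel" and bound: "\<And>z. \<bar>h z\<bar> \<le> (B::real)"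
  shows "(\<integral>\<omega>. h (tail_path \<psi> e (Suc s) (\<lambda>i. W i \<omega>)) \<partial>N)
    = (\<integral>\<omega>. (\<integral>y. h ((tail_path \<psi> e s (\<lambda>i. W i \<omega>))(Suc s := y))
          \<partial>limit_kernel K \<psi> s (tail_path \<psi> e s (\<lambda>i. W i \<omega>))) \<partial>N)"
proof -
  interpret prob_space N by fact
  have W_meas [measurable]: "W i \<in> borel_measurable N" for i
    using ind by (auto simp: indep_vars_def)
  define U where "U \<omega> = restrict (\<lambda>i. W i \<omega>) {..<s}" for \<omega>
  define V where "V \<omega> = restrict (\<lambda>i. W i \<omega>) {s}" for \<omega>
  have "indep_var (Pi\<^sub>M {..<s} (\<lambda>_. borel)) U (Pi\<^sub>M {s} (\<lambda>_. borel)) V"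
    unfolding U_def V_def by (rule indep_var_restrict[OF ind]) auto
  then have U: "U \<in> N \<rightarrow>\<^sub>M Pi\<^sub>M {..<s} (\<lambda>_. borel)" and V: "V \<in> N \<rightarrow>\<^sub>M Pi\<^sub>M {s} (\<lambda>_. borel)"
    and law: "distr N (Pi\<^sub>M {..<s} (\<lambda>_. borel)) U \<Otimes>\<^sub>M distr N (Pi\<^sub>M {s} (\<lambda>_. borel)) V
      = distr N (Pi\<^sub>M {..<s} (\<lambda>_. borel) \<Otimes>\<^sub>M Pi\<^sub>M {s} (\<lambda>_. borel)) (\<lambda>\<omega>. (U \<omega>, V \<omega>))"
    by (auto simp: indep_var_distribution_eq)
  have T: "tail_path \<psi> e s (U \<omega>) = tail_path \<psi> e s (\<lambda>i. W i \<omega>)" for \<omega>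
    by (rule tail_path_cong) (simp add: U_def)
  note [measurable] = h growth_measurable[OF \<psi>] tail_path_measurable[OF \<psi> subset_refl]
  have [measurable]: "(\<lambda>y. y s) \<in> borel_measurable (Pi\<^sub>M {s} (\<lambda>_. borel))"
    by (rule measurable_component_singleton) simp
  have "(\<integral>\<omega>. h (tail_path \<psi> e (Suc s) (\<lambda>i. W i \<omega>)) \<partial>N)
      = (\<integral>\<omega>. h ((tail_path \<psi> e s (U \<omega>))(Suc s := growth \<psi> s (tail_path \<psi> e s (U \<omega>)) * V \<omega> s)) \<partial>N)"
    by (simp add: T V_def)
  also have "\<dots> = (\<integral>\<omega>. (\<integral>\<omega>'. h ((tail_path \<psi> e s (U \<omega>))
      (Suc s := growth \<psi> s (tail_path \<psi> e s (U \<omega>)) * V \<omega>' s)) \<partial>N) \<partial>N)"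
    by (rule integral_product_law[OF N U V law, where B=B]) (measurable, rule bound)
  also have "\<dots> = (\<integral>\<omega>. (\<integral>y. h ((tail_path \<psi> e s (U \<omega>))(Suc s := y))
      \<partial>limit_kernel K \<psi> s (tail_path \<psi> e s (U \<omega>))) \<partial>N)"
    unfolding limit_kernel_def W[of s, symmetric]
    by (intro Bochner_Integration.integral_cong refl) (simp add: integral_distr V_def)
  finally show ?thesis by (simp add: T)
qed

definition limit_path :: "(nat \<Rightarrow> 'v \<Rightarrow> real) \<Rightarrow> real \<Rightarrow> nat \<Rightarrow> 'v \<Rightarrow> nat \<Rightarrow> real" where
  "limit_path Y e s \<omega> = (\<lambda>k. if k = 0 then e else if k \<le> s then Y k \<omega> else 0)"

text \<open>Positivity propagates: \<open>\<psi> s\<close> is positive on the positive half-line and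
  the innovations are almost surely positive. It guarantees that \<open>growth\<close> agrees with
  \<open>\<psi> s\<close> along the tail chain.\<close>

lemma tail_chain_pos:
  assumes tc: "tail_chain N H K \<psi> E0 Y \<epsilon>" and B1: "assumption_B1 \<pi> b K" and B2: "assumption_B2 b bs \<psi>"
    and s: "1 \<le> s"
  shows "AE \<omega> in N. 0 < Y s \<omega>"
  using s
proof (induction s rule: dec_induct)
  case base
  have Y: "Y 1 \<in> borel_measurable N" and law: "distr N borel (Y 1) = K"
    using tc unfolding tail_chain_def by blast+
  have "AE y in distr N borel (Y 1). 0 < y"
    unfolding law by (rule AE_pos_K[OF B1])
  then show ?case by (rule AE_distrD[OF Y])
next
  case (step s)
  have \<epsilon>: "\<epsilon> s \<in> borel_measurable N" and law: "distr N borel (\<epsilon> s) = K"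
    using tc step(1) unfolding tail_chain_def by blast+
  have "AE y in distr N borel (\<epsilon> s). 0 < y"
    unfolding law by (rule AE_pos_K[OF B1])
  then have "AE \<omega> in N. 0 < \<epsilon> s \<omega>" by (rule AE_distrD[OF \<epsilon>])
  moreover have "AE \<omega> in N. Y (Suc s) \<omega> = \<psi> s (Y s \<omega>) * \<epsilon> s \<omega>"
    using tc step by (simp add: tail_chain_def)
  ultimately show ?case
    using step.IH
    by eventually_elim (use B2 step(1) in \<open>simp add: assumption_B2_def\<close>)
qed

text \<open>The recursion holds almost surely, and so does positivity. On the common event the given
  variables are the path generated by the innovations, whose independence is at hand.\<close>

lemma limit_path_eq_tail_path:
  assumes tc: "tail_chain N H K \<psi> E0 Y \<epsilon>" and B1: "assumption_B1 \<pi> b K" and B2: "assumption_B2 b bs \<psi>"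
  shows "AE \<omega> in N. limit_path Y e s \<omega> = tail_path \<psi> e s (\<lambda>i. innovation Y \<epsilon> i \<omega>)"
proof (induction s)
  case 0
  then show ?case by (auto simp: limit_path_def fun_eq_iff)
next
  case (Suc s)
  have Suc_eq: "limit_path Y e (Suc s) \<omega> = (limit_path Y e s \<omega>)(Suc s := Y (Suc s) \<omega>)" for \<omega>
    by (auto simp: limit_path_def fun_eq_iff)
  show ?case
  proof (cases "s = 0")
    \<comment> \<open>\<open>Y 1\<close> does not come from the recursion; it is innovation 0 times
      the value 1 of \<open>growth\<close>.\<close>
    case True
    then show ?thesis
      by (intro AE_I2) (auto simp: limit_path_def growth_def innovation_def fun_eq_iff le_Suc_eq)
  next
    case False
    then have s: "1 \<le> s" by simp
    have "AE \<omega> in N. Y (Suc s) \<omega> = \<psi> s (Y s \<omega>) * \<epsilon> s \<omega>"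
      using tc s by (simp add: tail_chain_def)
    then show ?thesis
      using Suc tail_chain_pos[OF tc B1 B2 s]
    proof eventually_elim
      case (elim \<omega>)
      have "growth \<psi> s (limit_path Y e s \<omega>) = \<psi> s (Y s \<omega>)"
        using elim(3) s by (simp add: growth_def limit_path_def)
      then show ?case using elim(1,2) False by (simp add: Suc_eq innovation_def)
    qed
  qed
qed

text \<open>No trace of \<open>N\<close> remains on the right: the path at time 0 is the constant
  \<open>e\<close>, and everything later is carried by \<open>K\<close> and
  \<open>\<psi>\<close>.\<close>

lemma integral_limit_path:
  assumes tc: "tail_chain N H K \<psi> E0 Y \<epsilon>" and B1: "assumption_B1 \<pi> b K" and B2: "assumption_B2 b bs \<psi>"
    and g: "g \<in> borel_measurable borel" and bound: "\<And>z. \<bar>g z\<bar> \<le> (B::real)"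
  shows "(\<integral>\<omega>. g (limit_path Y e t \<omega>) \<partial>N) = iter (limit_kernel K \<psi>) g t 0 ((\<lambda>_. 0)(0 := e))"
proof -
  have N: "prob_space N" using tc by (simp add: tail_chain_def)
  interpret prob_space N by fact
  have K: "real_distribution K" using B1 by (simp add: assumption_B1_def half_line_distribution_def)
  have \<psi>: "\<And>s. 1 \<le> s \<Longrightarrow> continuous_on {0<..} (\<psi> s)" using B2 by (simp add: assumption_B2_def)
  have Y [measurable]: "Y s \<in> borel_measurable N" if "1 \<le> s" for s using tc that by (simp add: tail_chain_def)
  let ?W = "innovation Y \<epsilon>"
  let ?T = "\<lambda>s \<omega>. tail_path \<psi> e s (\<lambda>i. ?W i \<omega>)"
  have ind: "indep_vars (\<lambda>_. borel) ?W UNIV"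
    using tc by (intro innovation_indep_vars[OF N]) (auto simp: tail_chain_def)
  have W: "distr N borel (?W i) = K" for i
    using tc by (simp add: tail_chain_def innovation_def)
  have P: "limit_path Y e t \<in> borel_measurable N"
    unfolding limit_path_def
  proof (rule measurable_coordinatewise_then_product)
    show "(\<lambda>\<omega>. if k = 0 then e else if k \<le> t then Y k \<omega> else 0) \<in> borel_measurable N" for k
      using Y[of k] by (cases "k = 0"; cases "k \<le> t") auto
  qed
  have W_meas: "(\<lambda>\<omega>. \<lambda>i\<in>UNIV. ?W i \<omega>) \<in> N \<rightarrow>\<^sub>M Pi\<^sub>M UNIV (\<lambda>_. borel)"
    using ind by (intro measurable_restrict) (auto simp: indep_vars_def)
  have "tail_path \<psi> e t \<in> borel_measurable (Pi\<^sub>M UNIV (\<lambda>_. borel))"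
    by (rule tail_path_measurable[OF \<psi>]) auto
  from measurable_compose[OF W_meas this] have T: "?T t \<in> borel_measurable N"
    unfolding restrict_UNIV .
  have "(\<integral>\<omega>. g (limit_path Y e t \<omega>) \<partial>N) = (\<integral>\<omega>. g (?T t \<omega>) \<partial>N)"
    using limit_path_eq_tail_path[OF tc B1 B2, of e t] measurable_compose[OF P g] measurable_compose[OF T g]
    by (intro integral_cong_AE) auto
  also have "\<dots> = (\<integral>\<omega>. iter (limit_kernel K \<psi>) g t 0 (?T 0 \<omega>) \<partial>N)"
    by (rule integral_path[OF limit_kernel_measurable[OF K \<psi>] tail_path_step[OF N ind W \<psi>] g bound])
  also have "\<dots> = iter (limit_kernel K \<psi>) g t 0 ((\<lambda>_. 0)(0 := e))"
    by (simp add: prob_space)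
  finally show ?thesis .
qed

section \<open>Weak convergence on the half-line power\<close>

text \<open>
  Moves a test function to the type of all sequences, whose topology and Borel sets are those of
  the type classes, so that continuity and measurability can be checked coordinatewise.
\<close>

definition extend :: "nat \<Rightarrow> ((nat \<Rightarrow> real) \<Rightarrow> real) \<Rightarrow> (nat \<Rightarrow> real) \<Rightarrow> real" where
  "extend t f z = f (\<lambda>k\<in>{0..t}. max 0 (z k))"

text \<open>Clipping at 0 and restricting to \<open>{0..t}\<close> maps every real sequence
  continuously into the half-line power, so composition with \<open>f\<close> stays
  continuous.\<close>

lemma extend_continuous:
  assumes "continuous_map (half_line_power t) euclideanreal f"
  shows "continuous_on UNIV (extend t f)"
proof -
  have "continuous_map euclidean (half_line_power t) (\<lambda>z :: nat \<Rightarrow> real. \<lambda>k\<in>{0..t}. max 0 (z k))"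
    unfolding continuous_map_componentwise
  proof (intro conjI ballI)
    fix k assume "k \<in> {0..t}"
    moreover have "continuous_on UNIV (\<lambda>z :: nat \<Rightarrow> real. max 0 (z k))"
      by (intro continuous_on_max continuous_on_const continuous_on_product_coordinates)
    ultimately show "continuous_map euclidean half_line (\<lambda>z :: nat \<Rightarrow> real. (\<lambda>k\<in>{0..t}. max 0 (z k)) k)"
      by (simp add: continuous_map_in_subtopology)
  qed auto
  from continuous_map_compose[OF this assms] show ?thesis
    by (simp add: comp_def extend_def[abs_def])
qed

lemma extend_bound:
  assumes "\<And>x. x \<in> topspace (half_line_power t) \<Longrightarrow> \<bar>f x\<bar> \<le> B"
  shows "\<bar>extend t f z\<bar> \<le> B"
  unfolding extend_def by (rule assms) (auto simp: topspace_product_topology)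

text \<open>Clipping is invisible on almost surely nonnegative coordinates. Measurability is
  supplied by the extension, since \<open>f\<close> is controlled on the half-line power
  only.\<close>

lemma integral_half_line_power:
  assumes f: "continuous_map (half_line_power t) euclideanreal f"
    and V: "\<And>s. s \<le> t \<Longrightarrow> V s \<in> borel_measurable P" and nonneg: "AE \<omega> in P. \<forall>s\<le>t. 0 \<le> V s \<omega>"
  shows "(LINT x:topspace (half_line_power t)|distr P (Pi\<^sub>M {0..t} (\<lambda>_. borel)) (\<lambda>\<omega>. \<lambda>s\<in>{0..t}. V s \<omega>). f x)
    = (\<integral>\<omega>. extend t f (\<lambda>k. if k \<le> t then V k \<omega> else 0) \<partial>P)"
proof -
  let ?M = "Pi\<^sub>M {0..t} (\<lambda>_. borel) :: (nat \<Rightarrow> real) measure"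
  let ?T = "Pi\<^sub>E {0..t} (\<lambda>_. {0..}) :: (nat \<Rightarrow> real) set"
  let ?z = "\<lambda>x k. if k \<le> t then x k else (0 :: real)"
  have topspace: "topspace (half_line_power t) = ?T"
    by (simp add: topspace_product_topology)
  have [measurable]: "extend t f \<in> borel_measurable borel"
    by (rule borel_measurable_continuous_onI[OF extend_continuous[OF f]])
  have V_meas: "(\<lambda>\<omega>. \<lambda>s\<in>{0..t}. V s \<omega>) \<in> P \<rightarrow>\<^sub>M ?M"
    using V by (intro measurable_restrict) auto
  have [measurable]: "?z \<in> borel_measurable ?M"
  proof (rule measurable_coordinatewise_then_product)
    show "(\<lambda>x. ?z x k) \<in> borel_measurable ?M" for k
      by (cases "k \<le> t") auto
  qed
  have T_sets [measurable]: "?T \<in> sets ?M"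
    by (intro sets_PiM_I_finite) auto
  have eq: "indicator ?T x *\<^sub>R f x = indicator ?T x *\<^sub>R extend t f (?z x)" for x
  proof (cases "x \<in> ?T")
    case True
    then have "(\<lambda>k\<in>{0..t}. max 0 (?z x k)) = x"
      by (intro ext) (auto simp: PiE_iff extensional_def)
    then show ?thesis by (simp add: extend_def)
  qed simp
  have meas: "(\<lambda>x. indicator ?T x *\<^sub>R extend t f (?z x)) \<in> borel_measurable ?M"
    by measurable
  have z: "?z (\<lambda>s\<in>{0..t}. V s \<omega>) = (\<lambda>k. if k \<le> t then V k \<omega> else 0)" for \<omega>
    by auto
  have "(LINT x:?T|distr P ?M (\<lambda>\<omega>. \<lambda>s\<in>{0..t}. V s \<omega>). f x)
      = (\<integral>x. indicator ?T x *\<^sub>R extend t f (?z x) \<partial>distr P ?M (\<lambda>\<omega>. \<lambda>s\<in>{0..t}. V s \<omega>))"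
    unfolding set_lebesgue_integral_def by (simp only: eq)
  also have "\<dots> = (\<integral>\<omega>. indicator ?T (\<lambda>s\<in>{0..t}. V s \<omega>) *\<^sub>R extend t f (?z (\<lambda>s\<in>{0..t}. V s \<omega>)) \<partial>P)"
    by (rule integral_distr[OF V_meas meas])
  also have "\<dots> = (\<integral>\<omega>. extend t f (?z (\<lambda>s\<in>{0..t}. V s \<omega>)) \<partial>P)"
  proof (rule integral_cong_AE)
    show "(\<lambda>\<omega>. indicator ?T (\<lambda>s\<in>{0..t}. V s \<omega>) *\<^sub>R extend t f (?z (\<lambda>s\<in>{0..t}. V s \<omega>))) \<in> borel_measurable P"
      by (rule measurable_compose[OF V_meas meas])
    have "(\<lambda>x. extend t f (?z x)) \<in> borel_measurable ?M" by measurable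
    then show "(\<lambda>\<omega>. extend t f (?z (\<lambda>s\<in>{0..t}. V s \<omega>))) \<in> borel_measurable P"
      by (rule measurable_compose[OF V_meas])
    show "AE \<omega> in P. indicator ?T (\<lambda>s\<in>{0..t}. V s \<omega>) *\<^sub>R extend t f (?z (\<lambda>s\<in>{0..t}. V s \<omega>))
        = extend t f (?z (\<lambda>s\<in>{0..t}. V s \<omega>))"
      using nonneg
    proof eventually_elim
      case (elim \<omega>)
      then have "(\<lambda>s\<in>{0..t}. V s \<omega>) \<in> ?T" by auto
      then show ?case by simp
    qed
  qed
  also have "\<dots> = (\<integral>\<omega>. extend t f (\<lambda>k. if k \<le> t then V k \<omega> else 0) \<partial>P)"
    by (simp only: z)
  finally show ?thesis by (simp only: topspace)
qed

section \<open>Both laws as integrals of iterated kernels over the excess\<close>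

lemma uniform_measure_distr:
  assumes X: "X \<in> borel_measurable M" and A: "A \<in> sets borel"
  shows "uniform_measure (distr M borel X) A = distr (uniform_measure M (X -` A \<inter> space M)) borel X"
proof (rule measure_eqI)
  fix B assume "B \<in> sets (uniform_measure (distr M borel X) A)"
  then have B: "B \<in> sets borel" by simp
  have "X -` (A \<inter> B) \<inter> space M = (X -` A \<inter> space M) \<inter> (X -` B \<inter> space M)" by auto
  then show "emeasure (uniform_measure (distr M borel X) A) B
      = emeasure (distr (uniform_measure M (X -` A \<inter> space M)) borel X) B"
    using X A B measurable_sets[OF X A] measurable_sets[OF X B]
    by (simp add: emeasure_distr emeasure_uniform_measure)
qed simp

text \<open>Independence allows \<open>E0\<close> to be frozen at a value \<open>e\<close>, and the
  inner integral is then the one computed for a deterministic start.\<close>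

lemma integral_limit_law:
  assumes tc: "tail_chain N H K \<psi> E0 Y \<epsilon>" and B1: "assumption_B1 \<pi> b K" and B2: "assumption_B2 b bs \<psi>"
    and H: "half_line_distribution H" and t: "1 \<le> t"
    and f: "continuous_map (half_line_power t) euclideanreal f"
    and bound: "\<And>x. x \<in> topspace (half_line_power t) \<Longrightarrow> \<bar>f x\<bar> \<le> B"
  shows "(LINT x:topspace (half_line_power t)|limit_law N E0 Y t. f x)
    = (\<integral>e. iter (limit_kernel K \<psi>) (extend t f) t 0 ((\<lambda>_. 0)(0 := e)) \<partial>H)"
proof -
  have N: "prob_space N" using tc by (simp add: tail_chain_def)
  interpret prob_space N by fact
  have K: "real_distribution K" using B1 by (simp add: assumption_B1_def half_line_distribution_def)
  have \<psi>: "\<And>s. 1 \<le> s \<Longrightarrow> continuous_on {0<..} (\<psi> s)" using B2 by (simp add: assumption_B2_def)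
  have E0 [measurable]: "E0 \<in> borel_measurable N" and E0_law: "distr N borel E0 = H"
    and ind: "independent_variables N borel E0 (Pi\<^sub>M {1..t} (\<lambda>_. borel)) (\<lambda>\<omega>. \<lambda>s\<in>{1..t}. Y s \<omega>)"
    using tc t unfolding tail_chain_def by blast+
  have Y: "\<And>s. 1 \<le> s \<Longrightarrow> Y s \<in> borel_measurable N" using tc by (simp add: tail_chain_def)
  have g [measurable]: "extend t f \<in> borel_measurable borel"
    by (rule borel_measurable_continuous_onI[OF extend_continuous[OF f]])
  let ?Yv = "\<lambda>\<omega>. \<lambda>s\<in>{1..t}. Y s \<omega>"
  have Yv: "?Yv \<in> N \<rightarrow>\<^sub>M Pi\<^sub>M {1..t} (\<lambda>_. borel)"
    using Y by (intro measurable_restrict) auto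
  have "AE e in distr N borel E0. 0 \<le> e"
    unfolding E0_law using H by (intro AE_half_line) (auto simp: half_line_distribution_def)
  then have E0_nonneg: "AE \<omega> in N. 0 \<le> E0 \<omega>" by (rule AE_distrD[OF E0])
  have "AE \<omega> in N. \<forall>s\<in>{1..t}. 0 \<le> Y s \<omega>"
  proof (rule AE_finite_allI)
    fix s assume "s \<in> {1..t}"
    then have "AE \<omega> in N. 0 < Y s \<omega>" by (intro tail_chain_pos[OF tc B1 B2]) simp
    then show "AE \<omega> in N. 0 \<le> Y s \<omega>" by eventually_elim simp
  qed simp
  with E0_nonneg have nonneg: "AE \<omega> in N. \<forall>s\<le>t. 0 \<le> (if s = 0 then E0 \<omega> else Y s \<omega>)"
    by eventually_elim auto
  \<comment> \<open>Glues coordinate 0 to the vector indexed by \<open>{1..t}\<close>, the two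
    blocks whose independence is given.\<close>
  define h where "h e y = extend t f (\<lambda>k. if k = 0 then e else if k \<le> t then y k else 0)"
    for e and y :: "nat \<Rightarrow> real"
  have "(\<lambda>p (k::nat). if k = 0 then fst p :: real else if k \<le> t then snd p k else 0)
      \<in> borel_measurable (borel \<Otimes>\<^sub>M Pi\<^sub>M {1..t} (\<lambda>_. borel))"
  proof (rule measurable_coordinatewise_then_product)
    fix k
    show "(\<lambda>p. if k = 0 then fst p else if k \<le> t then snd p k else 0)
      \<in> borel_measurable (borel \<Otimes>\<^sub>M Pi\<^sub>M {1..t} (\<lambda>_. borel))"
      using measurable_compose[OF measurable_snd measurable_component_singleton, of k "{1..t}"]
      by (cases "k = 0"; cases "k \<le> t") auto
  qed
  from measurable_compose[OF this g]
  have h: "(\<lambda>(e, y). h e y) \<in> borel_measurable (borel \<Otimes>\<^sub>M Pi\<^sub>M {1..t} (\<lambda>_. borel))"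
    by (simp add: h_def case_prod_beta)
  have h_eq: "h e (?Yv \<omega>) = extend t f (limit_path Y e t \<omega>)" for e \<omega>
    by (auto simp: h_def limit_path_def intro!: arg_cong[of _ _ "extend t f"])
  have g_bound: "\<bar>extend t f z\<bar> \<le> B" for z by (rule extend_bound[OF bound])
  have "(LINT x:topspace (half_line_power t)|limit_law N E0 Y t. f x)
      = (\<integral>\<omega>. extend t f (\<lambda>k. if k \<le> t then (if k = 0 then E0 \<omega> else Y k \<omega>) else 0) \<partial>N)"
    unfolding limit_law_def
  proof (rule integral_half_line_power[OF f _ nonneg])
    show "(\<lambda>\<omega>. if s = 0 then E0 \<omega> else Y s \<omega>) \<in> borel_measurable N" for s
      using Y[of s] by (cases "s = 0") auto
  qed
  also have "\<dots> = (\<integral>\<omega>. h (E0 \<omega>) (?Yv \<omega>) \<partial>N)"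
    unfolding h_eq
    by (auto simp: limit_path_def intro!: Bochner_Integration.integral_cong arg_cong[of _ _ "extend t f"])
  also have "\<dots> = (\<integral>\<omega>. (\<integral>\<omega>'. h (E0 \<omega>) (?Yv \<omega>') \<partial>N) \<partial>N)"
    by (rule integral_product_law[OF N E0 Yv independent_variables_product_law[OF N ind] h, where B=B])
      (simp add: h_def g_bound)
  also have "\<dots> = (\<integral>\<omega>. iter (limit_kernel K \<psi>) (extend t f) t 0 ((\<lambda>_. 0)(0 := E0 \<omega>)) \<partial>N)"
    unfolding h_eq integral_limit_path[OF tc B1 B2 g g_bound] ..
  also have "\<dots> = (\<integral>e. iter (limit_kernel K \<psi>) (extend t f) t 0 ((\<lambda>_. 0)(0 := e)) \<partial>H)"
  proof -
    have [measurable]: "iter (limit_kernel K \<psi>) (extend t f) t 0 \<in> borel_measurable borel"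
      by (rule iter_measurable[OF limit_kernel_measurable[OF K \<psi>] g])
    show ?thesis unfolding E0_law[symmetric] by (subst integral_distr) auto
  qed
  finally show ?thesis .
qed

lemma excess_law:
  assumes F: "real_distribution F" "cdf F u < 1" and \<sigma>: "0 < \<sigma> u"
  shows "real_distribution (distr (uniform_measure F {u<..}) borel (\<lambda>x. (x - u) / \<sigma> u))"
    and "AE x in distr (uniform_measure F {u<..}) borel (\<lambda>x. (x - u) / \<sigma> u). 0 \<le> x"
proof -
  interpret real_distribution F by (rule F)
  have "prob {u<..} = 1 - cdf F u"
    using prob_compl[of "{..u}"] by (simp add: cdf_def Compl_eq_Diff_UNIV[symmetric])
  then have "emeasure F {u<..} \<noteq> 0" "emeasure F {u<..} \<noteq> \<infinity>"
    using F(2) by (simp_all add: emeasure_eq_measure)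
  then interpret U: prob_space "uniform_measure F {u<..}"
    by (rule prob_space_uniform_measure)
  show "real_distribution (distr (uniform_measure F {u<..}) borel (\<lambda>x. (x - u) / \<sigma> u))"
    by (rule U.real_distribution_distr) simp
  have "AE x in uniform_measure F {u<..}. 0 \<le> (x - u) / \<sigma> u"
    using \<sigma> by (intro AE_uniform_measureI) auto
  then show "AE x in distr (uniform_measure F {u<..}) borel (\<lambda>x. (x - u) / \<sigma> u). 0 \<le> x"
    by (subst AE_distr_iff) auto
qed

text \<open>Gives the prelimit law the shape of the limit law, with \<open>chain_kernel\<close> for
  \<open>limit_kernel\<close> and the excess law for its limit. The path at time 0 carries nothing
  but the excess, so the outer integral is one-dimensional.\<close>

lemma integral_conditional_law:
  assumes mc: "markov_chain M X F \<pi>" and bs: "\<And>s. 1 \<le> s \<Longrightarrow> positive_measurable (bs s)"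
    and u: "0 < u" "0 < \<sigma> u" and F: "cdf F u < 1"
    and f: "continuous_map (half_line_power t) euclideanreal f"
    and bound: "\<And>x. x \<in> topspace (half_line_power t) \<Longrightarrow> \<bar>f x\<bar> \<le> B"
  shows "(LINT x:topspace (half_line_power t)|conditional_law M X \<sigma> bs t u. f x)
      = (\<integral>x. iter (chain_kernel \<pi> \<sigma> bs u) (extend t f) t 0 ((\<lambda>_. 0)(0 := x))
          \<partial>distr (uniform_measure F {u<..}) borel (\<lambda>x. (x - u) / \<sigma> u))"
proof -
  interpret prob_space M using mc by (simp add: markov_chain_def)
  have X [measurable]: "X s \<in> borel_measurable M" for s
    using mc by (simp add: markov_chain_def)
  have \<pi>: "half_line_kernel \<pi>" and F_eq: "F = distr M borel (X 0)"
    using mc by (auto simp: markov_chain_def)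
  define A where "A = {\<omega> \<in> space M. u < X 0 \<omega>}"
  have A_sets [measurable]: "A \<in> sets M" unfolding A_def by measurable
  have "measure M A = 1 - cdf F u"
  proof -
    have "A = space M - (X 0 -` {..u} \<inter> space M)" by (auto simp: A_def)
    then show ?thesis by (simp add: prob_compl F_eq cdf_def measure_distr)
  qed
  then have A: "measure M A \<noteq> 0" using F by simp
  then have eA: "emeasure M A \<noteq> 0" "emeasure M A \<noteq> \<infinity>" by (simp_all add: emeasure_eq_measure)
  let ?P = "uniform_measure M A"
  interpret P: prob_space ?P by (rule prob_space_uniform_measure[OF eA])
  have AE_A: "AE \<omega> in ?P. \<omega> \<in> A" by (intro AE_uniform_measureI) auto
  have "X 0 -` {u<..} \<inter> space M = A" by (auto simp: A_def)
  then have "uniform_measure F {u<..} = distr ?P borel (X 0)"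
    unfolding F_eq by (subst uniform_measure_distr) auto
  then have law: "distr (uniform_measure F {u<..}) borel (\<lambda>x. (x - u) / \<sigma> u)
      = distr ?P borel (\<lambda>\<omega>. (X 0 \<omega> - u) / \<sigma> u)"
    by (simp add: distr_distr comp_def)
  have g: "extend t f \<in> borel_measurable borel"
    by (rule borel_measurable_continuous_onI[OF extend_continuous[OF f]])
  have g_bound: "\<bar>extend t f z\<bar> \<le> B" for z by (rule extend_bound[OF bound])
  have bs_pos: "0 < bs s (X 0 \<omega>)" if "1 \<le> s" "\<omega> \<in> space M" for s \<omega>
    using bs[OF that(1)] mc that(2) by (simp add: positive_measurable_def markov_chain_def)
  let ?V = "\<lambda>s \<omega>. if s = 0 then (X 0 \<omega> - u) / \<sigma> u else X s \<omega> / bs s (X 0 \<omega>)"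
  have path_eq: "(\<lambda>k. if k \<le> t then ?V k \<omega> else 0) = chain_path X \<sigma> bs u t \<omega>" for \<omega>
    by (auto simp: chain_path_def fun_eq_iff)
  have P_meas: "chain_path X \<sigma> bs u t \<in> borel_measurable M"
    using chain_path_measurable[OF mc bs] by (rule measurable_from_subalg[OF subalgebra_history[OF X]])
  have V_meas: "?V s \<in> borel_measurable ?P" if "s \<le> t" for s
  proof -
    have "(\<lambda>\<omega>. chain_path X \<sigma> bs u t \<omega> s) \<in> borel_measurable M"
      by (rule measurable_compose[OF P_meas measurable_product_coordinates])
    moreover have "(\<lambda>\<omega>. chain_path X \<sigma> bs u t \<omega> s) = ?V s"
      using that by (auto simp: chain_path_def fun_eq_iff)
    ultimately show ?thesis by simp
  qed
  have V_nonneg: "AE \<omega> in ?P. \<forall>s\<le>t. 0 \<le> ?V s \<omega>"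
    using AE_A
  proof eventually_elim
    case (elim \<omega>)
    then have "\<omega> \<in> space M" "u < X 0 \<omega>" by (auto simp: A_def)
    then show ?case
      using mc u bs_pos[of _ \<omega>] by (auto simp: markov_chain_def less_imp_le)
  qed
  have iter_meas: "iter (chain_kernel \<pi> \<sigma> bs u) (extend t f) t 0 \<in> borel_measurable borel"
    by (rule iter_measurable[OF chain_kernel_measurable[OF \<pi> bs] g])
  have "(LINT x:topspace (half_line_power t)|conditional_law M X \<sigma> bs t u. f x)
      = (\<integral>\<omega>. extend t f (chain_path X \<sigma> bs u t \<omega>) \<partial>?P)"
    unfolding conditional_law_def A_def[symmetric]
    by (subst integral_half_line_power[OF f V_meas V_nonneg]) (simp_all only: path_eq)
  also have "\<dots> = (\<integral>\<omega>. iter (chain_kernel \<pi> \<sigma> bs u) (extend t f) t 0 (chain_path X \<sigma> bs u 0 \<omega>) \<partial>?P)"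
    by (rule integral_path[OF chain_kernel_measurable[OF \<pi> bs]
          chain_path_step[where u=u and \<sigma>=\<sigma> and bs=bs, OF mc bs u A_def A] g g_bound])
  also have "\<dots> = (\<integral>x. iter (chain_kernel \<pi> \<sigma> bs u) (extend t f) t 0 ((\<lambda>_. 0)(0 := x))
      \<partial>distr ?P borel (\<lambda>\<omega>. (X 0 \<omega> - u) / \<sigma> u))"
  proof -
    have "chain_path X \<sigma> bs u 0 \<omega> = (\<lambda>_. 0)(0 := (X 0 \<omega> - u) / \<sigma> u)" for \<omega>
      by (auto simp: chain_path_def fun_eq_iff)
    moreover note [measurable] = iter_meas
    ultimately show ?thesis by (subst integral_distr) auto
  qed
  finally show "(LINT x:topspace (half_line_power t)|conditional_law M X \<sigma> bs t u. f x)
      = (\<integral>x. iter (chain_kernel \<pi> \<sigma> bs u) (extend t f) t 0 ((\<lambda>_. 0)(0 := x))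
          \<partial>distr (uniform_measure F {u<..}) borel (\<lambda>x. (x - u) / \<sigma> u))"
    unfolding law .
qed

theorem theorem2:
  fixes M :: "'w measure" and X :: "nat \<Rightarrow> 'w \<Rightarrow> real"
    and F\<^sub>0 H\<^sub>0 K :: "real measure" and \<pi> :: "real \<Rightarrow> real measure"
    and \<sigma> b :: "real \<Rightarrow> real" and bs \<psi> :: "nat \<Rightarrow> real \<Rightarrow> real"
    and N :: "'v measure" and E\<^sub>0 :: "'v \<Rightarrow> real" and Y \<epsilon> :: "nat \<Rightarrow> 'v \<Rightarrow> real"
    and t :: nat
  assumes "markov_chain M X F\<^sub>0 \<pi>"
    and "assumption_F0 F\<^sub>0 H\<^sub>0 \<sigma>"
    and "assumption_B1 \<pi> b K"
    and "assumption_B2 b bs \<psi>"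
    and "tail_chain N H\<^sub>0 K \<psi> E\<^sub>0 Y \<epsilon>"
    and "t \<ge> 1"
  shows "weakly_converges (half_line_power t)
           (conditional_law M X \<sigma> bs t) (limit_law N E\<^sub>0 Y t) at_top"
  unfolding weakly_converges_def
\<comment> \<open>Skorohod representation concerns sequences of laws, so the limit in the real
  threshold is tested along sequences tending to infinity.\<close>
proof (intro allI impI tendsto_at_topI_sequentially)
  note mc = assms(1) and F0 = assms(2) and B1 = assms(3) and B2 = assms(4) and tc = assms(5)
  fix f :: "(nat \<Rightarrow> real) \<Rightarrow> real" and u' :: "nat \<Rightarrow> real"
  assume "continuous_map (half_line_power t) euclideanreal f \<and> bounded (f ` topspace (half_line_power t))"
  then obtain B where f: "continuous_map (half_line_power t) euclideanreal f"
    and bound: "\<And>x. x \<in> topspace (half_line_power t) \<Longrightarrow> \<bar>f x\<bar> \<le> B"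
    by (auto simp: bounded_iff)
  assume u': "filterlim u' at_top sequentially"
  then have "eventually (\<lambda>n. 0 < u' n) sequentially"
    by (simp add: filterlim_at_top_dense)
  then obtain m where m: "\<And>n. m \<le> n \<Longrightarrow> 0 < u' n"
    by (auto simp: eventually_sequentially)
  \<comment> \<open>The shift makes every threshold positive, as undoing the normalisation requires;
    \<open>LIMSEQ_offset\<close> reverts it.\<close>
  define u where "u n = u' (n + m)" for n
  have u: "filterlim u at_top sequentially" and u_pos: "0 < u n" for n
    using filterlim_compose[OF u' filterlim_add_const_nat_at_top[of m]] m by (auto simp: u_def[abs_def])
  have \<sigma>: "0 < \<sigma> (u n)" and F: "cdf F\<^sub>0 (u n) < 1" for n
    using F0 u_pos[of n] by (auto simp: assumption_F0_def positive_measurable_def)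
  have H: "half_line_distribution H\<^sub>0" and \<pi>: "half_line_kernel \<pi>"
    using F0 mc by (auto simp: assumption_F0_def markov_chain_def)
  then have H': "real_distribution H\<^sub>0" "AE x in H\<^sub>0. 0 \<le> x"
    using AE_half_line by (auto simp: half_line_distribution_def)
  have F\<^sub>0: "real_distribution F\<^sub>0"
    using mc by (auto simp: markov_chain_def intro: prob_space.real_distribution_distr)
  have K: "real_distribution K" using B1 by (simp add: assumption_B1_def half_line_distribution_def)
  have bs: "1 \<le> s \<Longrightarrow> positive_measurable (bs s)" and \<psi>: "1 \<le> s \<Longrightarrow> continuous_on {0<..} (\<psi> s)" for s
    using B2 by (auto simp: assumption_B2_def)
  let ?g = "extend t f"
  let ?\<mu> = "\<lambda>u. distr (uniform_measure F\<^sub>0 {u<..}) borel (\<lambda>x. (x - u) / \<sigma> u)"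
  let ?z = "\<lambda>x :: real. (\<lambda>_. 0)(0 := x)"
  have \<mu>: "real_distribution (?\<mu> (u n))" "AE x in ?\<mu> (u n). 0 \<le> x" for n
    by (rule excess_law[where \<sigma>=\<sigma>, OF F\<^sub>0 F \<sigma>])+
  have cond: "(LINT x:topspace (half_line_power t)|conditional_law M X \<sigma> bs t (u n). f x)
      = (\<integral>x. iter (chain_kernel \<pi> \<sigma> bs (u n)) ?g t 0 (?z x) \<partial>?\<mu> (u n))" for n
    by (rule integral_conditional_law[where \<sigma>=\<sigma>, OF mc bs u_pos \<sigma> F f bound])
  have g: "?g \<in> borel_measurable borel"
    by (rule borel_measurable_continuous_onI[OF extend_continuous[OF f]])
  have g_bound: "\<bar>?g z\<bar> \<le> B" for z by (rule extend_bound[OF bound])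
  note \<kappa> = chain_kernel_measurable[where \<sigma>=\<sigma>, OF \<pi> bs] and \<kappa>_lim = limit_kernel_measurable[OF K \<psi>]
  note iter_meas [measurable] = iter_measurable[OF \<kappa> g] iter_measurable[OF \<kappa>_lim g]
  have "(\<lambda>n. \<integral>x. iter (chain_kernel \<pi> \<sigma> bs (u n)) ?g t 0 (?z x) \<partial>?\<mu> (u n))
      \<longlonglongrightarrow> (\<integral>x. iter (limit_kernel K \<psi>) ?g t 0 (?z x) \<partial>H\<^sub>0)"
  \<comment> \<open>The excess has no exceptional values: at time 0 the positivity condition of
    \<open>iter_tendsto\<close> is empty, so an atom of \<open>H\<^sub>0\<close> at 0 does no
    harm.\<close>
  proof (rule extended_continuous_mapping[where P="\<lambda>_. True" and B=B])
    show "weak_conv_m (\<lambda>n. ?\<mu> (u n)) H\<^sub>0"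
      using F0 by (intro half_line_weak_conv[where N="?\<mu>", OF _ u \<mu> H']) (auto simp: assumption_F0_def)
    fix x xs assume xs: "xs \<longlonglongrightarrow> (x :: real)"
    show "(\<lambda>n. iter (chain_kernel \<pi> \<sigma> bs (u n)) ?g t 0 (?z (xs n)))
        \<longlonglongrightarrow> iter (limit_kernel K \<psi>) ?g t 0 (?z x)"
    proof (rule iter_tendsto[OF \<kappa> \<kappa>_lim chain_kernel_weak_conv[OF \<pi> B1 B2 u] _ extend_continuous[OF f] g_bound])
      \<comment> \<open>\<open>growth\<close> is positive at every path because of its default
        value, so scaling preserves the positivity of \<open>K\<close>.\<close>
      show "AE y in limit_kernel K \<psi> s z. 0 < y" for s z
      proof -
        interpret real_distribution K by (rule K)
        have "AE y in K. 0 < growth \<psi> s z * y"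
          using AE_pos_K[OF B1] by eventually_elim (simp add: growth_pos[OF B2])
        then show ?thesis unfolding limit_kernel_def by (subst AE_distr_iff) auto
      qed
    qed (use xs in \<open>auto intro: tendsto_fun_upd\<close>)
  qed (use \<mu>(1) H' in \<open>auto intro!: iter_bound[OF \<kappa> g g_bound]\<close>)
  then have "(\<lambda>n. LINT x:topspace (half_line_power t)|conditional_law M X \<sigma> bs t (u n). f x)
      \<longlonglongrightarrow> (LINT x:topspace (half_line_power t)|limit_law N E\<^sub>0 Y t. f x)"
    by (simp only: cond integral_limit_law[OF tc B1 B2 H assms(6) f bound])
  then show "(\<lambda>n. LINT x:topspace (half_line_power t)|conditional_law M X \<sigma> bs t (u' n). f x)
      \<longlonglongrightarrow> (LINT x:topspace (half_line_power t)|limit_law N E\<^sub>0 Y t. f x)"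
    unfolding u_def by (rule LIMSEQ_offset)
qed

end
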